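(* Let $A$ be a finite abelian group. All free abelian groups and all free groups admit actions by cellular automata (that is, by automorphisms on a full shift $\Sigma^{\mathbb{Z}}$ for some finite alphabet $\Sigma$) that do not have $A$-cancellation.
   Context: For a finite alphabet $\Sigma$ with $|\Sigma|\ge 2$, $\mathrm{Aut}(\Sigma^{\mathbb{Z}})$ is the group of homeomorphisms of the full shift $\Sigma^{\mathbb{Z}}$ commuting with the shift $\sigma(x)_i = x_{i+1}$; its elements are the reversible cellular automata. An action by automorphisms on $\Sigma^{\mathbb{Z}}$ is an action through a homomorphism into $\mathrm{Aut}(\Sigma^{\mathbb{Z}})$. A $G$-system $(G,X)$ is a zero-dimensional compact metrizable space $X$ with an action of the discrete group $G$ by homeomorphisms. Let $A$, $B$ be finite abelian groups and $\theta : X \to \mathrm{Hom}(A,B)$ continuous ($\mathrm{Hom}(A,B)$ discrete). $(G,X)$ has $A$-cancellation with respect to $(\theta,B)$ if there exists a finitely supported map $f : G\to A$, $f\neq 0$, such that $\sum_{g\in G}\theta(gx)(f(g)) = 0$ for all $x\in X$. $(G,X)$ has $A$-cancellation if it has $A$-cancellation with respect to every such $(\theta,B)$ (for all finite abelian $B$).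
   Formalization: The free abelian and free groups are assumed countable; for nonzero A the claim fails for uncountable groups, since the automorphism group of a full shift is countable, so some k ≠ 1 acts trivially and f(1) = a, f(k) = -a cancels. *)

theory Defs
  imports
    "HOL-Analysis.Analysis"
    "HOL-Algebra.Group_Action"
    "HOL-Algebra.Free_Abelian_Groups"
begin

section \<open>Full shifts and their automorphism groups\<close>

definition full_shift :: "'s set \<Rightarrow> (int \<Rightarrow> 's) topology" where
  "full_shift \<Sigma> = product_topology (\<lambda>_. discrete_topology \<Sigma>) UNIV"

definition shift :: "(int \<Rightarrow> 's) \<Rightarrow> (int \<Rightarrow> 's)" where
  "shift x = (\<lambda>i. x (i + 1))"

definition shift_automorphisms :: "'s set \<Rightarrow> ((int \<Rightarrow> 's) \<Rightarrow> (int \<Rightarrow> 's)) set" where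
  "shift_automorphisms \<Sigma> =
     {h \<in> Bij (topspace (full_shift \<Sigma>)).
        homeomorphic_map (full_shift \<Sigma>) (full_shift \<Sigma>) h \<and>
        (\<forall>x \<in> topspace (full_shift \<Sigma>). h (shift x) = shift (h x))}"

definition Aut_full_shift :: "'s set \<Rightarrow> ((int \<Rightarrow> 's) \<Rightarrow> (int \<Rightarrow> 's)) monoid" where
  "Aut_full_shift \<Sigma> =
     BijGroup (topspace (full_shift \<Sigma>)) \<lparr>carrier := shift_automorphisms \<Sigma>\<rparr>"


section \<open>$G$-systems and cancellation\<close>

definition G_system ::
  "('g, 'm) monoid_scheme \<Rightarrow> 'x topology \<Rightarrow> ('g \<Rightarrow> 'x \<Rightarrow> 'x) \<Rightarrow> bool" where
  "G_system G X \<phi> \<longleftrightarrow>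
     compact_space X \<and> metrizable_space X \<and> X dim_le 0 \<and>
     group_action G (topspace X) \<phi> \<and>
     (\<forall>g \<in> carrier G. homeomorphic_map X X (\<phi> g))"

text \<open>Homomorphisms are taken extensional, so that each of them is represented by exactly
  one function.\<close>

definition Hom :: "('a, 'k) monoid_scheme \<Rightarrow> ('b, 'l) monoid_scheme \<Rightarrow> ('a \<Rightarrow> 'b) set" where
  "Hom A B = hom A B \<inter> extensional (carrier A)"

text \<open>The abelian groups are written multiplicatively:
  zero is \<open>\<one>\<close>, and the sum over the group is \<^const>\<open>gfinprod\<close>, the product over the (here
  finite) set of indices with a nontrivial factor.\<close>

definition has_cancellation_wrt ::
  "('g, 'm) monoid_scheme \<Rightarrow> 'x topology \<Rightarrow> ('g \<Rightarrow> 'x \<Rightarrow> 'x) \<Rightarrow>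
   ('a, 'k) monoid_scheme \<Rightarrow> ('x \<Rightarrow> 'a \<Rightarrow> 'b) \<Rightarrow> ('b, 'l) monoid_scheme \<Rightarrow> bool" where
  "has_cancellation_wrt G X \<phi> A \<theta> B \<longleftrightarrow>
     (\<exists>f \<in> carrier G \<rightarrow> carrier A.
        finite {g \<in> carrier G. f g \<noteq> \<one>\<^bsub>A\<^esub>} \<and>
        (\<exists>g \<in> carrier G. f g \<noteq> \<one>\<^bsub>A\<^esub>) \<and>
        (\<forall>x \<in> topspace X. gfinprod B (\<lambda>g. \<theta> (\<phi> g x) (f g)) (carrier G) = \<one>\<^bsub>B\<^esub>))"

text \<open>A definition cannot quantify over types. Every finite group is isomorphic to one whose
  elements are natural numbers, so \<open>B\<close> ranges over the latter.\<close>

definition has_cancellation ::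
  "('g, 'm) monoid_scheme \<Rightarrow> 'x topology \<Rightarrow> ('g \<Rightarrow> 'x \<Rightarrow> 'x) \<Rightarrow>
   ('a, 'k) monoid_scheme \<Rightarrow> bool" where
  "has_cancellation G X \<phi> A \<longleftrightarrow>
     (\<forall>(B :: nat monoid) \<theta>.
        comm_group B \<and> finite (carrier B) \<and>
        continuous_map X (discrete_topology (Hom A B)) \<theta> \<longrightarrow>
        has_cancellation_wrt G X \<phi> A \<theta> B)"


section \<open>Free abelian groups and free groups\<close>

text \<open>A basis of \<open>G\<close> can be chosen inside \<open>G\<close>, so indexing by sets of elements of the
  type of \<open>G\<close> is no restriction.\<close>

definition is_free_abelian_group :: "('g, 'm) monoid_scheme \<Rightarrow> bool" where
  "is_free_abelian_group G \<longleftrightarrow> group G \<and> (\<exists>S :: 'g set. G \<cong> free_Abelian_group S)"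

text \<open>Words are lists of letters \<open>(s, True)\<close>, standing for \<open>s\<close>, and \<open>(s, False)\<close>,
  standing for the inverse of \<open>s\<close>.\<close>

primrec word_eval :: "('g, 'm) monoid_scheme \<Rightarrow> ('g \<times> bool) list \<Rightarrow> 'g" where
  "word_eval G [] = \<one>\<^bsub>G\<^esub>"
| "word_eval G (l # w) =
     (if snd l then fst l else inv\<^bsub>G\<^esub> (fst l)) \<otimes>\<^bsub>G\<^esub> word_eval G w"

definition reduced_word :: "('g \<times> bool) list \<Rightarrow> bool" where
  "reduced_word w \<longleftrightarrow> successively (\<lambda>k l. \<not> (fst k = fst l \<and> snd k \<noteq> snd l)) w"

definition free_basis :: "('g, 'm) monoid_scheme \<Rightarrow> 'g set \<Rightarrow> bool" where
  "free_basis G S \<longleftrightarrow>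
     S \<subseteq> carrier G \<and> generate G S = carrier G \<and>
     (\<forall>w. w \<noteq> [] \<and> set w \<subseteq> S \<times> UNIV \<and> reduced_word w \<longrightarrow> word_eval G w \<noteq> \<one>\<^bsub>G\<^esub>)"

definition is_free_group :: "('g, 'm) monoid_scheme \<Rightarrow> bool" where
  "is_free_group G \<longleftrightarrow> group G \<and> (\<exists>S. free_basis G S)"


section \<open>Actions by automorphisms are systems\<close>

lemma topspace_full_shift: "topspace (full_shift \<Sigma>) = {x. \<forall>i. x i \<in> \<Sigma>}"
  by (auto simp: full_shift_def PiE_def)

lemma shift_in_full_shift:
  "x \<in> topspace (full_shift \<Sigma>) \<Longrightarrow> shift x \<in> topspace (full_shift \<Sigma>)"
  by (simp add: topspace_full_shift shift_def)

lemma subgroup_shift_automorphisms: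
  "subgroup (shift_automorphisms \<Sigma>) (BijGroup (topspace (full_shift \<Sigma>)))"
proof -
  let ?X = "full_shift \<Sigma>"
  let ?T = "topspace ?X"
  interpret B: group "BijGroup ?T" by (rule group_BijGroup)
  show ?thesis
  proof (rule B.subgroupI)
    show "shift_automorphisms \<Sigma> \<subseteq> carrier (BijGroup ?T)"
      by (auto simp: shift_automorphisms_def BijGroup_def)
    have "homeomorphic_map ?X ?X (\<lambda>x\<in>?T. x)"
      by (rule homeomorphic_map_eq[of _ _ id]) auto
    then have "(\<lambda>x\<in>?T. x) \<in> shift_automorphisms \<Sigma>"
      by (auto simp: shift_automorphisms_def id_Bij shift_in_full_shift)
    then show "shift_automorphisms \<Sigma> \<noteq> {}" by blast
  next
    fix h assume h: "h \<in> shift_automorphisms \<Sigma>"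
    then have hB: "h \<in> Bij ?T" and hh: "homeomorphic_map ?X ?X h"
      and hs: "\<And>x. x \<in> ?T \<Longrightarrow> h (shift x) = shift (h x)"
      by (auto simp: shift_automorphisms_def)
    have bij: "bij_betw h ?T ?T" using hB by (simp add: Bij_def)
    let ?k = "inv_into ?T h"
    have kT: "?k x \<in> ?T" if "x \<in> ?T" for x
      using bij_betw_inv_into[OF bij] that by (auto simp: bij_betw_def)
    from hh obtain k where k: "homeomorphic_maps ?X ?X h k"
      using homeomorphic_map_maps by blast
    have "k x = ?k x" if "x \<in> ?T" for x
    proof -
      have "k x \<in> ?T" "h (k x) = x"
        using k that by (auto simp: homeomorphic_maps_def continuous_map_def)
      then show ?thesis using bij by (metis bij_betw_inv_into_left)
    qed
    then have kr: "k x = (\<lambda>x\<in>?T. ?k x) x" if "x \<in> ?T" for x using that by simp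
    have "homeomorphic_map ?X ?X k"
      using k homeomorphic_maps_map by blast
    then have "homeomorphic_map ?X ?X (\<lambda>x\<in>?T. ?k x)"
      by (rule homeomorphic_map_eq) (use kr in auto)
    moreover have "?k (shift x) = shift (?k x)" if "x \<in> ?T" for x
    proof -
      have "h (shift (?k x)) = shift x"
        using hs[OF kT[OF that]] bij that by (simp add: bij_betw_inv_into_right)
      then show ?thesis
        using bij_betw_inv_into_left[OF bij shift_in_full_shift[OF kT[OF that]]] by simp
    qed
    ultimately show "inv\<^bsub>BijGroup ?T\<^esub> h \<in> shift_automorphisms \<Sigma>"
      using hB
      by (simp add: inv_BijGroup shift_automorphisms_def restrict_inv_into_Bij shift_in_full_shift)
  next
    fix h k assume h: "h \<in> shift_automorphisms \<Sigma>" and k: "k \<in> shift_automorphisms \<Sigma>"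
    then have hB: "h \<in> Bij ?T" "k \<in> Bij ?T"
      by (auto simp: shift_automorphisms_def)
    have kT: "k x \<in> ?T" if "x \<in> ?T" for x
      using hB(2) that by (auto simp: Bij_def bij_betw_def)
    have "homeomorphic_map ?X ?X (h \<circ> k)"
      using h k by (auto simp: shift_automorphisms_def intro: homeomorphic_map_compose)
    then have "homeomorphic_map ?X ?X (compose ?T h k)"
      by (rule homeomorphic_map_eq) (auto simp: compose_def)
    moreover have "compose ?T h k (shift x) = shift (compose ?T h k x)" if "x \<in> ?T" for x
      using h k kT[OF that] that
      by (simp add: shift_automorphisms_def compose_def shift_in_full_shift)
    ultimately have "compose ?T h k \<in> shift_automorphisms \<Sigma>"
      using hB by (simp add: shift_automorphisms_def compose_Bij)
    then show "h \<otimes>\<^bsub>BijGroup ?T\<^esub> k \<in> shift_automorphisms \<Sigma>"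
      using hB by (simp add: BijGroup_def)
  qed
qed

lemma group_Aut_full_shift: "group (Aut_full_shift \<Sigma>)"
  unfolding Aut_full_shift_def
  by (rule subgroup.subgroup_is_group[OF subgroup_shift_automorphisms group_BijGroup])

lemma full_shift_dim_le_0: "full_shift \<Sigma> dim_le 0"
proof (rule dimension_le.intros)
  fix V a assume V: "openin (full_shift \<Sigma>) V" and a: "a \<in> V"
  then have "\<exists>U. finite {i. U i \<noteq> \<Sigma>} \<and> (\<forall>i. U i \<subseteq> \<Sigma>) \<and> a \<in> Pi\<^sub>E UNIV U \<and> Pi\<^sub>E UNIV U \<subseteq> V"
    unfolding full_shift_def openin_product_topology_alt by simp
  then obtain U where U: "finite {i. U i \<noteq> \<Sigma>}" "\<And>i. U i \<subseteq> \<Sigma>" "a \<in> Pi\<^sub>E UNIV U"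
      "Pi\<^sub>E UNIV U \<subseteq> V"
    by blast
  have o: "openin (full_shift \<Sigma>) (Pi\<^sub>E UNIV U)"
    unfolding full_shift_def using U by (subst openin_PiE_gen) auto
  have c: "closedin (full_shift \<Sigma>) (Pi\<^sub>E UNIV U)"
    unfolding full_shift_def using U by (subst closedin_product_topology) auto
  have "full_shift \<Sigma> frontier_of (Pi\<^sub>E UNIV U) = {}"
    using o c by (metis clopenin_eq_frontier_of)
  then have "subtopology (full_shift \<Sigma>) (full_shift \<Sigma> frontier_of (Pi\<^sub>E UNIV U)) dim_le (0 - 1)"
    by (simp add: dimension_le.simps[of _ "- 1"])
  with o U show "\<exists>W. a \<in> W \<and> W \<subseteq> V \<and> openin (full_shift \<Sigma>) W \<and>
      subtopology (full_shift \<Sigma>) (full_shift \<Sigma> frontier_of W) dim_le (0 - 1)"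
    by blast
qed simp

lemma G_system_full_shift:
  assumes "group G" "finite \<Sigma>" and \<phi>: "\<phi> \<in> hom G (Aut_full_shift \<Sigma>)"
  shows "G_system G (full_shift \<Sigma>) \<phi>"
  unfolding G_system_def
proof (intro conjI ballI)
  show "compact_space (full_shift \<Sigma>)"
    using assms by (simp add: full_shift_def compact_space_product_topology
        compact_space_discrete_topology)
  show "metrizable_space (full_shift \<Sigma>)"
    by (simp add: full_shift_def metrizable_space_product_topology
        metrizable_space_discrete_topology)
  show "full_shift \<Sigma> dim_le 0" by (rule full_shift_dim_le_0)
  have "\<phi> \<in> hom G (BijGroup (topspace (full_shift \<Sigma>)))"
    using \<phi> subgroup.subset[OF subgroup_shift_automorphisms[of \<Sigma>]]
    by (auto simp: hom_def Aut_full_shift_def)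
  then show "group_action G (topspace (full_shift \<Sigma>)) \<phi>"
    by (simp add: group_action_def group_hom_def group_hom_axioms_def assms group_BijGroup)
  fix g assume "g \<in> carrier G"
  then have "\<phi> g \<in> shift_automorphisms \<Sigma>"
    using \<phi> by (auto simp: hom_def Aut_full_shift_def)
  then show "homeomorphic_map (full_shift \<Sigma>) (full_shift \<Sigma>) (\<phi> g)"
    by (simp add: shift_automorphisms_def)
qed

end

theory Submission
  imports
    Defs
    "HOL-Algebra.Weak_Morphisms"
    "HOL-Library.Numeral_Type"
begin

text \<open>
  It suffices to let the homomorphism \<open>\<theta> x\<close> be multiplication by an integer weight that depends
  on the symbol \<open>x 0\<close> only, followed by an isomorphism from \<open>A\<close> to a group \<open>B\<close> of natural numbers.

  For free groups, configurations carry a track of markers, which never changes, and a data track.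
  A basis element acts as the product of two involutions, each of which exchanges the data at the
  ends of the isolated gaps of one particular length between consecutive markers. Given \<open>f\<close>, take
  an element \<open>g\<close> of its support whose word is longest and markers whose gaps spell this
  word: then \<open>g\<close> alone, among the support, carries the datum at the far end of the path to \<open>0\<close>.

  For free abelian groups it is not enough to permute data, because the orbits of cells grow
  linearly. Here the immutable track sorts the cells into disjoint belts, one kind for each basis
  element, along which that element moves the data; a further track with values in \<open>\<int>/6\<close> adds up
  the data at a reference cell of each belt. This sum is a sum over infinitely many belts, but each
  group element changes it by a locally computable amount. On the paperfolding sequence all belts
  are infinite, and the reference cell of belt \<open>i\<close> is within a distance that depends only on \<open>i\<close>,
  so that one sees sums \<open>\<Sum>\<^sub>i b\<^sub>i(k\<^sub>i)\<close> with arbitrary sequences \<open>b\<^sub>i\<close>. Changing each \<open>b\<^sub>i\<close> in one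
  place isolates a single coefficient of \<open>f\<close>.\<close>

section \<open>Cellular maps and the weighted cancellation criterion\<close>

text \<open>Cellular automata as block maps, in the form of the Curtis-Hedlund-Lyndon theorem. They
  act on all functions into a type, so that composition and the group law need no restriction to a
  carrier.\<close>

definition cellular :: "((int \<Rightarrow> 's) \<Rightarrow> (int \<Rightarrow> 's)) \<Rightarrow> bool" where
  "cellular F \<longleftrightarrow> (\<forall>x. F (shift x) = shift (F x)) \<and>
     (\<exists>W. finite W \<and> (\<forall>x y. (\<forall>i\<in>W. x i = y i) \<longrightarrow> F x 0 = F y 0))"

lemma cellular_translate:
  assumes "cellular F"
  shows "F (\<lambda>j. x (j + i)) = (\<lambda>j. F x (j + i))"
proof (induction i rule: int_induct[where k = 0])
  case base
  show ?case by simp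
next
  case (step1 i)
  have "F (shift (\<lambda>j. x (j + i))) = shift (F (\<lambda>j. x (j + i)))"
    using assms by (simp add: cellular_def)
  then show ?case
    by (simp add: step1(2) shift_def add_ac)
next
  case (step2 i)
  have "shift (\<lambda>j. x (j + (i - 1))) = (\<lambda>j. x (j + i))"
    by (simp add: shift_def)
  then have "shift (F (\<lambda>j. x (j + (i - 1)))) = (\<lambda>j. F x (j + i))"
    using assms step2(2) by (metis cellular_def)
  then have "shift (F (\<lambda>j. x (j + (i - 1)))) (k - 1) = F x (k - 1 + i)" for k
    by simp
  then show ?case
    by (simp add: shift_def fun_eq_iff algebra_simps)
qed

lemma cellular_id: "cellular id"
  unfolding cellular_def by (auto intro: exI[of _ "{0}"])

lemma cellular_comp:
  assumes F: "cellular F" and H: "cellular H"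
  shows "cellular (F \<circ> H)"
proof -
  obtain W where W: "finite W" "\<And>x y. (\<forall>i\<in>W. x i = y i) \<Longrightarrow> F x 0 = F y 0"
    using F by (auto simp: cellular_def)
  obtain V where V: "finite V" "\<And>x y. (\<forall>i\<in>V. x i = y i) \<Longrightarrow> H x 0 = H y 0"
    using H by (auto simp: cellular_def)
  \<comment> \<open>The window of a composite is a sumset: the inner map is evaluated at each
    \<open>i\<close> in \<open>W\<close>, hence reads \<open>V\<close> translated by
    \<open>i\<close>.\<close>
  let ?U = "(\<lambda>(i, j). i + j) ` (V \<times> W)"
  have "F (H x) 0 = F (H y) 0" if xy: "\<forall>i\<in>?U. x i = y i" for x y
  proof (rule W(2), rule ballI)
    fix i assume "i \<in> W"
    then have "H (\<lambda>j. x (j + i)) 0 = H (\<lambda>j. y (j + i)) 0"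
      using xy by (intro V(2)) auto
    then show "H x i = H y i"
      by (simp add: cellular_translate[OF H])
  qed
  moreover have "finite ?U" using V W by simp
  ultimately show ?thesis
    using F H unfolding cellular_def by (auto intro!: exI[of _ ?U])
qed

lemma cellular_window:
  assumes "cellular F"
  shows "\<exists>W. finite W \<and> (\<forall>x y. (\<forall>j\<in>W. x j = y j) \<longrightarrow> F x i = F y i)"
proof -
  obtain W where W: "finite W" "\<And>x y. (\<forall>i\<in>W. x i = y i) \<Longrightarrow> F x 0 = F y 0"
    using assms by (auto simp: cellular_def)
  have "F x i = F y i" if "\<forall>j\<in>(\<lambda>j. j + i) ` W. x j = y j" for x y
    using W(2)[of "\<lambda>j. x (j + i)" "\<lambda>j. y (j + i)"] that
    by (simp add: cellular_translate[OF assms])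
  then show ?thesis using W(1) by (intro exI[of _ "(\<lambda>j. j + i) ` W"]) blast
qed

section \<open>From block maps to automorphisms of full shifts\<close>

text \<open>A map that reads finitely many coordinates is constant on the cylinders that fix these
  coordinates, and such cylinders are open.\<close>

lemma continuous_map_full_shift_discrete:
  assumes "\<And>x. x \<in> topspace (full_shift \<Sigma>) \<Longrightarrow> h x \<in> T"
    and W: "finite W"
    and h: "\<And>x y. \<lbrakk>x \<in> topspace (full_shift \<Sigma>); y \<in> topspace (full_shift \<Sigma>);
              \<forall>i\<in>W. x i = y i\<rbrakk> \<Longrightarrow> h x = h y"
  shows "continuous_map (full_shift \<Sigma>) (discrete_topology T) h"
proof -
  let ?X = "full_shift \<Sigma>"
  have "openin ?X {x \<in> topspace ?X. h x \<in> U}" for U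
  proof (subst openin_subopen, intro ballI)
    fix x assume x: "x \<in> {x \<in> topspace ?X. h x \<in> U}"
    let ?C = "Pi\<^sub>E UNIV (\<lambda>i. if i \<in> W then {x i} else \<Sigma>)"
    have "openin ?X ?C"
      unfolding full_shift_def using W x
      by (subst openin_PiE_gen)
         (auto simp: topspace_full_shift intro!: finite_subset[OF _ W] split: if_splits)
    moreover have "x \<in> ?C" using x by (auto simp: topspace_full_shift)
    moreover have "?C \<subseteq> {x \<in> topspace ?X. h x \<in> U}"
    proof
      fix y assume y: "y \<in> ?C"
      then have "y i \<in> (if i \<in> W then {x i} else \<Sigma>)" for i
        by (auto simp: PiE_def Pi_def)
      then have "y \<in> topspace ?X" "\<forall>i\<in>W. y i = x i"
        using x by (auto simp: topspace_full_shift) (metis singletonD)+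
      then show "y \<in> {x \<in> topspace ?X. h x \<in> U}"
        using h[of x y] x by simp
    qed
    ultimately show "\<exists>T. openin ?X T \<and> x \<in> T \<and> T \<subseteq> {x \<in> topspace ?X. h x \<in> U}"
      by blast
  qed
  then show ?thesis
    using assms(1) by (auto simp: continuous_map_def)
qed

text \<open>Conjugation by \<open>enc\<close> moves a reversible block map from a type to the
  alphabet \<open>range enc\<close>. As the inverse is a block map too, both directions are
  continuous. The restriction to \<open>topspace X\<close> is the extensionality that
  \<open>Bij\<close> demands.\<close>

lemma recode_shift_automorphism:
  fixes F :: "(int \<Rightarrow> 's) \<Rightarrow> (int \<Rightarrow> 's)" and enc :: "'s \<Rightarrow> 't"
  assumes "inj enc" and F: "cellular F" and F': "cellular F'"
    and FF': "F \<circ> F' = id" "F' \<circ> F = id"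
  defines "X \<equiv> full_shift (range enc)"
  shows "(\<lambda>x\<in>topspace X. enc \<circ> F (inv_into UNIV enc \<circ> x)) \<in> shift_automorphisms (range enc)"
proof -
  define R where "R = (\<lambda>F :: (int \<Rightarrow> 's) \<Rightarrow> (int \<Rightarrow> 's). \<lambda>x\<in>topspace X. enc \<circ> F (inv_into UNIV enc \<circ> x))"
  have dec: "inv_into UNIV enc \<circ> (enc \<circ> z) = z" for z :: "int \<Rightarrow> 's"
    using \<open>inj enc\<close> by (auto simp: fun_eq_iff)
  have enc: "enc \<circ> (inv_into UNIV enc \<circ> x) = x" if "x \<in> topspace X" for x
    using that unfolding X_def topspace_full_shift by (auto simp: fun_eq_iff f_inv_into_f)
  have encX: "enc \<circ> z \<in> topspace X" for z :: "int \<Rightarrow> 's"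
    by (simp add: X_def topspace_full_shift)
  have cont: "continuous_map X X (R E)" if E: "cellular E" for E
  proof -
    have "continuous_map X (discrete_topology (range enc)) (\<lambda>x. R E x i)" for i
    proof -
      obtain W where W: "finite W" "\<And>x y. (\<forall>j\<in>W. x j = y j) \<Longrightarrow> E x i = E y i"
        using cellular_window[OF E] by blast
      show ?thesis
        unfolding X_def
      proof (rule continuous_map_full_shift_discrete[OF _ W(1)])
        show "R E x i \<in> range enc" if "x \<in> topspace (full_shift (range enc))" for x
          using that by (simp add: R_def X_def)
        show "R E x i = R E y i" if "x \<in> topspace (full_shift (range enc))"
          "y \<in> topspace (full_shift (range enc))" "\<forall>i\<in>W. x i = y i" for x y
          using that W(2)[of "inv_into UNIV enc \<circ> x" "inv_into UNIV enc \<circ> y"] by (simp add: R_def X_def)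
      qed
    qed
    then have "continuous_map X (product_topology (\<lambda>_. discrete_topology (range enc)) UNIV) (R E)"
      by (simp add: continuous_map_componentwise_UNIV)
    then show ?thesis
      by (simp only: X_def full_shift_def)
  qed
  have inverse: "R E' (R E x) = x" if "E' \<circ> E = id" "x \<in> topspace X" for E E' x
    using that enc encX dec by (simp add: R_def pointfree_idE)
  have homeo: "homeomorphic_maps X X (R F) (R F')"
    using cont F F' inverse FF' by (auto simp: homeomorphic_maps_def)
  moreover have "R F (shift x) = shift (R F x)" if "x \<in> topspace X" for x
  proof -
    have "inv_into UNIV enc \<circ> shift x = shift (inv_into UNIV enc \<circ> x)" by (auto simp: shift_def)
    then have "F (inv_into UNIV enc \<circ> shift x) = shift (F (inv_into UNIV enc \<circ> x))"
      using F by (simp add: cellular_def)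
    then show ?thesis
      using that shift_in_full_shift[of x "range enc"]
      by (auto simp: R_def X_def shift_def)
  qed
  moreover have "R F \<in> Bij (topspace X)"
  proof -
    have "bij_betw (R F) (topspace X) (topspace X)"
      using homeo
      by (intro bij_betwI[of _ _ _ "R F'"]) (auto simp: homeomorphic_maps_def continuous_map_def)
    then show ?thesis by (simp add: Bij_def R_def)
  qed
  moreover have "homeomorphic_map X X (R F)"
    using homeo homeomorphic_maps_map by blast
  ultimately have "R F \<in> shift_automorphisms (range enc)"
    unfolding shift_automorphisms_def X_def by blast
  then show ?thesis by (simp only: R_def)
qed

section \<open>Cancellation as an equation between weighted products\<close>

lemma (in comm_group) hom_image_finprod:
  assumes "comm_group H" "h \<in> hom G H" "finite I" "f \<in> I \<rightarrow> carrier G"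
  shows "finprod H (\<lambda>i. h (f i)) I = h (finprod G f I)"
proof -
  interpret H: comm_group H by fact
  interpret h: group_hom G H h using assms(2) by unfold_locales
  show ?thesis using assms(3,4)
    by (induction I) (auto simp: H.finprod_insert finprod_insert Pi_def)
qed

text \<open>The witness against cancellation is a copy \<open>B\<close> of \<open>A\<close>, with
  \<open>\<theta> x\<close> raising to the power \<open>v (x 0)\<close>. Cancellation by
  \<open>f\<close> would make all weighted products of the values of \<open>f\<close> trivial, which
  \<open>no_cancel\<close> refutes.\<close>

lemma no_cancellationI:
  fixes A :: "('a, 'k) monoid_scheme" and G :: "('g, 'm) monoid_scheme"
    and F :: "'g \<Rightarrow> (int \<Rightarrow> 's::finite) \<Rightarrow> (int \<Rightarrow> 's)" and v :: "'s \<Rightarrow> int"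
  assumes A: "comm_group A" "finite (carrier A)" and G: "group G"
    and card: "card (UNIV :: 's set) \<ge> 2"
    and F: "\<And>g. g \<in> carrier G \<Longrightarrow> cellular (F g)"
    and F_one: "F \<one>\<^bsub>G\<^esub> = id"
    and F_mult: "\<And>g h. \<lbrakk>g \<in> carrier G; h \<in> carrier G\<rbrakk> \<Longrightarrow> F (g \<otimes>\<^bsub>G\<^esub> h) = F g \<circ> F h"
    and no_cancel: "\<And>f. \<lbrakk>f \<in> carrier G \<rightarrow> carrier A; finite {g \<in> carrier G. f g \<noteq> \<one>\<^bsub>A\<^esub>};
          {g \<in> carrier G. f g \<noteq> \<one>\<^bsub>A\<^esub>} \<noteq> {}\<rbrakk> \<Longrightarrow>
        \<exists>x. finprod A (\<lambda>g. f g [^]\<^bsub>A\<^esub> v (F g x 0)) {g \<in> carrier G. f g \<noteq> \<one>\<^bsub>A\<^esub>} \<noteq> \<one>\<^bsub>A\<^esub>"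
  shows "\<exists>(\<Sigma> :: nat set) \<phi>. finite \<Sigma> \<and> card \<Sigma> \<ge> 2 \<and> \<phi> \<in> hom G (Aut_full_shift \<Sigma>) \<and>
           \<not> has_cancellation G (full_shift \<Sigma>) \<phi> A"
proof -
  interpret A: comm_group A by fact
  interpret G: group G by fact
  obtain enc :: "'s \<Rightarrow> nat" where enc: "inj enc"
    using finite_imp_inj_to_nat_seg[of "UNIV :: 's set"] by auto
  define \<Sigma> where "\<Sigma> = range enc"
  define X where "X = full_shift \<Sigma>"
  define \<phi> where "\<phi> = (\<lambda>g. \<lambda>x\<in>topspace X. enc \<circ> F g (inv_into UNIV enc \<circ> x))"
  have dec: "inv_into UNIV enc \<circ> (enc \<circ> z) = z" for z :: "int \<Rightarrow> 's"
    using enc by (auto simp: fun_eq_iff)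
  have encX: "enc \<circ> z \<in> topspace X" for z :: "int \<Rightarrow> 's"
    by (simp add: X_def \<Sigma>_def topspace_full_shift)
  have aut: "\<phi> g \<in> shift_automorphisms \<Sigma>" if g: "g \<in> carrier G" for g
  proof -
    \<comment> \<open>Reversibility comes from the group: \<open>F\<close> at the inverse element is
      the inverse block map.\<close>
    have "F g \<circ> F (inv\<^bsub>G\<^esub> g) = id" "F (inv\<^bsub>G\<^esub> g) \<circ> F g = id"
      using g F_mult[of g "inv\<^bsub>G\<^esub> g"] F_mult[of "inv\<^bsub>G\<^esub> g" g] F_one by auto
    then show ?thesis
      using recode_shift_automorphism[OF enc F F, of g "inv\<^bsub>G\<^esub> g"] g
      by (simp add: \<phi>_def X_def \<Sigma>_def)
  qed
  have hom: "\<phi> \<in> hom G (Aut_full_shift \<Sigma>)"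
  proof (rule homI)
    fix g h assume g: "g \<in> carrier G" and h: "h \<in> carrier G"
    have "\<phi> g \<in> Bij (topspace X)" "\<phi> h \<in> Bij (topspace X)"
      using aut g h by (auto simp: shift_automorphisms_def X_def)
    moreover have "\<phi> (g \<otimes>\<^bsub>G\<^esub> h) = compose (topspace X) (\<phi> g) (\<phi> h)"
      by (rule ext) (simp add: \<phi>_def compose_def encX dec F_mult[OF g h])
    ultimately show "\<phi> (g \<otimes>\<^bsub>G\<^esub> h) = \<phi> g \<otimes>\<^bsub>Aut_full_shift \<Sigma>\<^esub> \<phi> h"
      by (simp add: Aut_full_shift_def BijGroup_def X_def)
  qed (use aut in \<open>simp add: Aut_full_shift_def\<close>)
  obtain e :: "'a \<Rightarrow> nat" where e: "inj_on e (carrier A)"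
    using finite_imp_inj_to_nat_seg[OF A(2)] by auto
  define B where "B = image_group e A"
  have iso: "e \<in> iso A B"
    unfolding B_def by (rule inj_imp_image_group_iso[OF e])
  have "group B"
    unfolding B_def by (rule A.inj_imp_image_group_is_group[OF e])
  then have B: "comm_group B"
    using A.iso_imp_comm_group iso by (metis group.is_monoid is_isoI)
  have finB: "finite (carrier B)"
    by (simp add: B_def image_group_carrier A(2))
  have homB: "e \<in> hom A B" using iso by (simp add: iso_def)
  have oneB: "\<one>\<^bsub>B\<^esub> = e \<one>\<^bsub>A\<^esub>" by (simp add: B_def image_group_one)
  \<comment> \<open>Powers are homomorphisms since \<open>A\<close> is commutative; only the
    coordinate \<open>0\<close> is read, which gives continuity.\<close>
  define \<theta> where "\<theta> = (\<lambda>x :: int \<Rightarrow> nat. \<lambda>a\<in>carrier A. e (a [^]\<^bsub>A\<^esub> v (inv_into UNIV enc (x 0))))"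
  have "(\<lambda>a\<in>carrier A. e (a [^]\<^bsub>A\<^esub> n)) \<in> Hom A B" for n :: int
    using homB by (auto simp: Hom_def hom_def Pi_def A.int_pow_distrib)
  then have cont: "continuous_map X (discrete_topology (Hom A B)) \<theta>"
    unfolding X_def
    by (intro continuous_map_full_shift_discrete[of _ _ _ "{0}"]) (auto simp: \<theta>_def)
  have "\<not> has_cancellation_wrt G X \<phi> A \<theta> B"
  proof
    assume "has_cancellation_wrt G X \<phi> A \<theta> B"
    then obtain f where f: "f \<in> carrier G \<rightarrow> carrier A"
      and fin: "finite {g \<in> carrier G. f g \<noteq> \<one>\<^bsub>A\<^esub>}"
      and ne: "{g \<in> carrier G. f g \<noteq> \<one>\<^bsub>A\<^esub>} \<noteq> {}"
      and one: "\<And>x. x \<in> topspace X \<Longrightarrow>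
          gfinprod B (\<lambda>g. \<theta> (\<phi> g x) (f g)) (carrier G) = \<one>\<^bsub>B\<^esub>"
      unfolding has_cancellation_wrt_def by blast
    interpret B: comm_group B by (rule B)
    let ?S = "{g \<in> carrier G. f g \<noteq> \<one>\<^bsub>A\<^esub>}"
    obtain x where x: "finprod A (\<lambda>g. f g [^]\<^bsub>A\<^esub> v (F g x 0)) ?S \<noteq> \<one>\<^bsub>A\<^esub>"
      using no_cancel[OF f fin ne] by blast
    let ?p = "\<lambda>g. f g [^]\<^bsub>A\<^esub> v (F g x 0)"
    have p: "?p \<in> carrier G \<rightarrow> carrier A" using f by auto
    have val: "\<theta> (\<phi> g (enc \<circ> x)) (f g) = e (?p g)" if "g \<in> carrier G" for g
      using that f encX[of x] dec enc by (auto simp: \<theta>_def \<phi>_def)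
    have eB: "e a \<in> carrier B" if "a \<in> carrier A" for a
      using that homB by (auto simp: hom_def)
    have pB: "e (?p g) \<in> carrier B" if "g \<in> carrier G" for g
      using eB p that by blast
    \<comment> \<open>A power of the unit is the unit, so the product over the group reduces to one
      over the support.\<close>
    have trivial: "\<theta> (\<phi> g (enc \<circ> x)) (f g) = \<one>\<^bsub>B\<^esub>" if "g \<in> carrier G - ?S" for g
      using val[of g] that by (simp add: oneB)
    have "gfinprod B (\<lambda>g. \<theta> (\<phi> g (enc \<circ> x)) (f g)) (carrier G) = gfinprod B (\<lambda>g. e (?p g)) ?S"
      by (rule B.gfinprod_mono_neutral_cong_right[OF _ trivial]) (use val pB in auto)
    also have "\<dots> = finprod B (\<lambda>g. e (?p g)) ?S"
      using fin pB by (intro B.gfinprod_eq_finprod) auto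
    also have "\<dots> = e (finprod A ?p ?S)"
      by (rule A.hom_image_finprod[OF B homB fin]) (use p in auto)
    finally have "e (finprod A ?p ?S) = e \<one>\<^bsub>A\<^esub>"
      using one[OF encX] by (simp add: oneB)
    moreover have "finprod A ?p ?S \<in> carrier A"
      using p by (intro A.finprod_closed) auto
    ultimately show False
      using x e by (auto dest: inj_onD)
  qed
  then have "\<not> has_cancellation G X \<phi> A"
    unfolding has_cancellation_def using B finB cont by blast
  moreover have "finite \<Sigma>" "card \<Sigma> \<ge> 2"
    using card enc by (auto simp: \<Sigma>_def card_image)
  ultimately show ?thesis using hom unfolding X_def by blast
qed

section \<open>Free groups\<close>

definition word_action :: "('l \<Rightarrow> 'x \<Rightarrow> 'x) \<Rightarrow> 'l list \<Rightarrow> 'x \<Rightarrow> 'x" where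
  "word_action T u = foldr (\<lambda>l. (\<circ>) (T l)) u id"

lemma word_action_Nil [simp]: "word_action T [] = id"
  by (simp add: word_action_def)

lemma word_action_Cons [simp]: "word_action T (l # u) = T l \<circ> word_action T u"
  by (simp add: word_action_def)

lemma word_action_append [simp]: "word_action T (u @ u') = word_action T u \<circ> word_action T u'"
  by (induction u) (auto simp: o_assoc)

lemma (in group) word_eval_closed:
  "set u \<subseteq> S \<times> UNIV \<Longrightarrow> S \<subseteq> carrier G \<Longrightarrow> word_eval G u \<in> carrier G"
  by (induction u) (auto split: if_splits)

lemma (in group) word_eval_append:
  assumes "set u \<subseteq> S \<times> UNIV" "set u' \<subseteq> S \<times> UNIV" "S \<subseteq> carrier G"
  shows "word_eval G (u @ u') = word_eval G u \<otimes> word_eval G u'"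
  using assms(1)
proof (induction u)
  case Nil
  then show ?case using word_eval_closed[OF assms(2,3)] by simp
next
  case (Cons l u)
  then have "(if snd l then fst l else inv (fst l)) \<in> carrier G" "set u \<subseteq> S \<times> UNIV"
    using assms(3) by auto
  then show ?case
    using Cons.IH word_eval_closed[OF assms(2,3)] word_eval_closed[OF _ assms(3), of u]
    by (simp add: m_assoc)
qed

lemma (in group) word_eval_surj:
  assumes "S \<subseteq> carrier G" "g \<in> generate G S"
  shows "\<exists>u. set u \<subseteq> S \<times> UNIV \<and> word_eval G u = g"
  using assms(2)
proof induction
  case one
  then show ?case by (intro exI[of _ "[]"]) simp
next
  case (incl h)
  then show ?case using assms(1) by (intro exI[of _ "[(h, True)]"]) auto
next
  case (inv h)
  then show ?case using assms(1) by (intro exI[of _ "[(h, False)]"]) auto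
next
  case (eng g h)
  then obtain u v where "set u \<subseteq> S \<times> UNIV" "word_eval G u = g" "set v \<subseteq> S \<times> UNIV" "word_eval G v = h"
    by blast
  then show ?case using word_eval_append[OF _ _ assms(1), of u v] by (intro exI[of _ "u @ v"]) auto
qed

text \<open>Free reduction from the right end: a new first letter either cancels the head of the
  reduced tail or is put in front of it. Inverse letters act as inverse maps, so each cancellation
  preserves the action along with the value.\<close>

lemma (in group) ex_reduced_word:
  assumes S: "S \<subseteq> carrier G" and u: "set u \<subseteq> S \<times> UNIV"
    and T: "\<And>s b. s \<in> S \<Longrightarrow> T (s, b) \<circ> T (s, \<not> b) = id"
  shows "\<exists>r. set r \<subseteq> S \<times> UNIV \<and> reduced_word r \<and> word_eval G r = word_eval G u \<and>
             word_action T r = word_action T u"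
  using u
proof (induction u)
  case Nil
  show ?case by (intro exI[of _ "[]"]) (simp add: reduced_word_def)
next
  case (Cons l u)
  then obtain r where r: "set r \<subseteq> S \<times> UNIV" "reduced_word r" "word_eval G r = word_eval G u"
    "word_action T r = word_action T u" by auto
  obtain s b where l: "l = (s, b)" "s \<in> S" using Cons.prems by auto
  show ?case
  proof (cases "\<exists>r'. r = (s, \<not> b) # r'")
    case True
    then obtain r' where r': "r = (s, \<not> b) # r'" by blast
    have s: "s \<in> carrier G" "word_eval G r' \<in> carrier G"
      using l r r' S word_eval_closed[OF _ S, of r'] by auto
    have "word_eval G (l # u) =
        (if b then s else inv s) \<otimes> ((if b then inv s else s) \<otimes> word_eval G r')"
      using l(1) r(3) r' by auto
    then have "word_eval G (l # u) = word_eval G r'"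
      using s by (cases b) (simp_all add: m_assoc[symmetric])
    moreover have "word_action T (l # u) = T (s, b) \<circ> (T (s, \<not> b) \<circ> word_action T r')"
      using l(1) r(4) r' by simp
    then have "word_action T (l # u) = word_action T r'"
      by (simp add: T[OF l(2)] o_assoc)
    moreover have "reduced_word r'" "set r' \<subseteq> S \<times> UNIV"
      using r(1,2) r' by (auto simp: reduced_word_def successively_Cons)
    ultimately show ?thesis by (intro exI[of _ r']) simp
  next
    case False
    then have "reduced_word (l # r)"
      using r(2) l(1) by (cases r) (auto simp: reduced_word_def)
    then show ?thesis using r l by (intro exI[of _ "l # r"]) auto
  qed
qed

text \<open>The universal property of a free group in terms of words: \<open>r\<close> picks a
  reduced word for each element, and freeness makes the action independent of the word.\<close>

lemma (in group) free_basis_action: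
  assumes "free_basis G S" and T: "\<And>s b. s \<in> S \<Longrightarrow> T (s, b) \<circ> T (s, \<not> b) = id"
  obtains r where "\<And>g. g \<in> carrier G \<Longrightarrow> set (r g) \<subseteq> S \<times> UNIV"
    and "\<And>g. g \<in> carrier G \<Longrightarrow> reduced_word (r g)"
    and "\<And>g. g \<in> carrier G \<Longrightarrow> word_eval G (r g) = g"
    and "word_action T (r \<one>) = id"
    and "\<And>g h. \<lbrakk>g \<in> carrier G; h \<in> carrier G\<rbrakk> \<Longrightarrow>
           word_action T (r (g \<otimes> h)) = word_action T (r g) \<circ> word_action T (r h)"
proof -
  have S: "S \<subseteq> carrier G" and gen: "generate G S = carrier G"
    and free: "\<And>w. \<lbrakk>w \<noteq> []; set w \<subseteq> S \<times> UNIV; reduced_word w\<rbrakk> \<Longrightarrow> word_eval G w \<noteq> \<one>"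
    using assms(1) unfolding free_basis_def by auto
  have "\<exists>u. set u \<subseteq> S \<times> UNIV \<and> reduced_word u \<and> word_eval G u = g" if "g \<in> carrier G" for g
    using word_eval_surj[OF S, of g] ex_reduced_word[OF S, of _ T] T that gen by metis
  then obtain r where r: "\<And>g. g \<in> carrier G \<Longrightarrow> set (r g) \<subseteq> S \<times> UNIV"
    "\<And>g. g \<in> carrier G \<Longrightarrow> reduced_word (r g)"
    "\<And>g. g \<in> carrier G \<Longrightarrow> word_eval G (r g) = g" by metis
  \<comment> \<open>The reduced form of a word for the unit is empty by freeness, so the word acts
    as the identity.\<close>
  have trivial: "word_action T u = id" if "set u \<subseteq> S \<times> UNIV" "word_eval G u = \<one>" for u
    using ex_reduced_word[OF S that(1), of T] T free that(2)
    by (metis word_action_Nil)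
  have eq: "word_action T u = word_action T u'"
    if u: "set u \<subseteq> S \<times> UNIV" "set u' \<subseteq> S \<times> UNIV" "word_eval G u = word_eval G u'" for u u'
  proof -
    \<comment> \<open>A word for the inverse element acts as a left inverse of \<open>u'\<close> and
      as a right inverse of \<open>u\<close>, so \<open>u\<close> and \<open>u'\<close> act
      alike.\<close>
    let ?u = "r (inv (word_eval G u))"
    have c: "word_eval G u \<in> carrier G" using word_eval_closed[OF u(1) S] .
    have 1: "word_action T ?u \<circ> word_action T u' = id"
      using trivial[of "?u @ u'"] word_eval_append[OF _ _ S, of ?u u'] c r u by simp
    have 2: "word_action T u \<circ> word_action T ?u = id"
      using trivial[of "u @ ?u"] word_eval_append[OF _ _ S, of u ?u] c r u by simp
    show ?thesis using 1 2 by (metis comp_assoc comp_id id_comp)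
  qed
  show thesis
  proof (rule that[OF r])
    show "word_action T (r \<one>) = id" using eq[of "r \<one>" "[]"] r by simp
    show "word_action T (r (g \<otimes> h)) = word_action T (r g) \<circ> word_action T (r h)"
      if "g \<in> carrier G" "h \<in> carrier G" for g h
      using that eq[of "r (g \<otimes> h)" "r g @ r h"] r word_eval_append[OF _ _ S, of "r g" "r h"] by simp
  qed
qed

section \<open>Swapping data across isolated gaps\<close>

definition gap :: "int \<Rightarrow> (int \<Rightarrow> bool) \<Rightarrow> int \<Rightarrow> bool" where
  "gap d w p \<longleftrightarrow> w p \<and> w (p + d) \<and> (\<forall>j. p < j \<and> j < p + d \<longrightarrow> \<not> w j)"

text \<open>Excluding an equal gap directly before or after makes the exchanged pairs disjoint, so
  that exchanging ends is an involution.\<close>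

definition isolated_gap :: "int \<Rightarrow> (int \<Rightarrow> bool) \<Rightarrow> int \<Rightarrow> bool" where
  "isolated_gap d w p \<longleftrightarrow> gap d w p \<and> \<not> gap d w (p - d) \<and> \<not> gap d w (p + d)"

definition gap_swap :: "int \<Rightarrow> (int \<Rightarrow> bool) \<Rightarrow> int \<Rightarrow> int" where
  "gap_swap d w p =
     (if isolated_gap d w p then p + d else if isolated_gap d w (p - d) then p - d else p)"

definition swap_map :: "int \<Rightarrow> (int \<Rightarrow> bool \<times> 'b) \<Rightarrow> int \<Rightarrow> bool \<times> 'b" where
  "swap_map d x = (\<lambda>j. (fst (x j), snd (x (gap_swap d (fst \<circ> x) j))))"

lemma gap_swap_involution: "gap_swap d w (gap_swap d w p) = p"
  by (auto simp: gap_swap_def isolated_gap_def)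

lemma fst_swap_map: "fst \<circ> swap_map d x = fst \<circ> x"
  by (auto simp: swap_map_def)

lemma swap_map_involution: "swap_map d \<circ> swap_map d = id"
proof
  fix x :: "int \<Rightarrow> bool \<times> 'b"
  have "swap_map d (swap_map d x) j = x j" for j
    unfolding swap_map_def[of d "swap_map d x"] fst_swap_map
    by (simp add: swap_map_def gap_swap_involution)
  then show "(swap_map d \<circ> swap_map d) x = id x" by auto
qed

lemma gap_cong:
  assumes "\<And>j. \<bar>j\<bar> \<le> 2 * \<bar>d\<bar> \<Longrightarrow> w j = w' j" "\<bar>p\<bar> \<le> 2 * \<bar>d\<bar>" "\<bar>p + d\<bar> \<le> 2 * \<bar>d\<bar>"
  shows "gap d w p = gap d w' p"
proof -
  have "w j = w' j" if "p < j" "j < p + d" for j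
    using assms(2,3) that by (intro assms(1)) linarith
  then show ?thesis using assms by (auto simp: gap_def)
qed

lemma cellular_swap_map: "cellular (swap_map d)"
proof -
  have gap: "gap d (\<lambda>i. w (i + 1)) p = gap d w (p + 1)" for w p
  proof -
    have "(\<forall>j. p < j \<and> j < p + d \<longrightarrow> \<not> w (j + 1)) =
          (\<forall>j. p + 1 < j \<and> j < p + 1 + d \<longrightarrow> \<not> w j)"
    proof (intro iffI allI impI)
      show "\<not> w j" if "\<forall>j. p < j \<and> j < p + d \<longrightarrow> \<not> w (j + 1)" "p + 1 < j \<and> j < p + 1 + d" for j
        using that(2) that(1)[rule_format, of "j - 1"] by simp
      show "\<not> w (j + 1)" if "\<forall>j. p + 1 < j \<and> j < p + 1 + d \<longrightarrow> \<not> w j" "p < j \<and> j < p + d" for j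
        using that(2) that(1)[rule_format, of "j + 1"] by simp
    qed
    then show ?thesis by (simp add: gap_def add_ac)
  qed
  have swap: "gap_swap d (\<lambda>i. w (i + 1)) p + 1 = gap_swap d w (p + 1)" for w p
    by (simp add: gap_swap_def isolated_gap_def gap algebra_simps)
  have "swap_map d (shift x) = shift (swap_map d x)" for x :: "int \<Rightarrow> bool \<times> 'b"
  proof -
    have "fst \<circ> shift x = (\<lambda>i. (fst \<circ> x) (i + 1))" by (auto simp: shift_def)
    then show ?thesis
      using swap[of "fst \<circ> x"] by (auto simp: swap_map_def shift_def)
  qed
  moreover have "swap_map d x 0 = swap_map d y 0"
    if agree: "\<forall>i\<in>{-2 * \<bar>d\<bar>..2 * \<bar>d\<bar>}. x i = y i" for x y :: "int \<Rightarrow> bool \<times> 'b"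
  proof -
    have xy: "x i = y i" if "\<bar>i\<bar> \<le> 2 * \<bar>d\<bar>" for i
      using that by (intro bspec[OF agree]) (simp add: abs_le_iff)
    \<comment> \<open>Both tests in \<open>gap_swap\<close> at \<open>0\<close> concern gaps that
      start at one of these four points; the points and the far ends of the gaps lie within the
      window.\<close>
    have "gap d (fst \<circ> x) p = gap d (fst \<circ> y) p" if "p \<in> {-2 * d, -d, 0, d}" for p
      using that by (intro gap_cong) (auto simp: xy)
    then have "gap_swap d (fst \<circ> x) 0 = gap_swap d (fst \<circ> y) 0"
      by (simp add: gap_swap_def isolated_gap_def)
    moreover have "\<bar>gap_swap d (fst \<circ> y) 0\<bar> \<le> 2 * \<bar>d\<bar>" by (simp add: gap_swap_def)
    ultimately show ?thesis by (simp add: swap_map_def xy)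
  qed
  ultimately show ?thesis
    unfolding cellular_def by (auto intro!: exI[of _ "{-2 * \<bar>d\<bar>..2 * \<bar>d\<bar>}"])
qed

primrec walk :: "(int \<Rightarrow> bool) \<Rightarrow> int list \<Rightarrow> int \<Rightarrow> int" where
  "walk w [] j = j"
| "walk w (d # ds) j = walk w ds (gap_swap d w j)"

lemma walk_append: "walk w (ds @ es) j = walk w es (walk w ds j)"
  by (induction ds arbitrary: j) auto

lemma fst_word_action_swap_map: "fst \<circ> word_action swap_map ds x = fst \<circ> x"
  by (induction ds) (simp_all add: fst_swap_map)

text \<open>The outermost map is the first to redirect the reading position, so the walk takes the
  gap lengths from left to right. No swap changes the markers, hence all steps see the same
  ones.\<close>

lemma snd_word_action_swap_map:
  "snd (word_action swap_map ds x j) = snd (x (walk (fst \<circ> x) ds j))"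
proof (induction ds arbitrary: j)
  case (Cons d ds)
  have "snd (word_action swap_map (d # ds) x j) =
      snd (word_action swap_map ds x (gap_swap d (fst \<circ> x) j))"
    by (simp add: swap_map_def[of d "word_action swap_map ds x"] fst_word_action_swap_map)
  also have "\<dots> = snd (x (walk (fst \<circ> x) ds (gap_swap d (fst \<circ> x) j)))"
    by (rule Cons)
  finally show ?case by (simp only: walk.simps)
qed simp

section \<open>Walks among markers that spell a list\<close>

definition marker :: "int list \<Rightarrow> int \<Rightarrow> bool" where
  "marker ds j \<longleftrightarrow> (\<exists>k\<le>length ds. j = sum_list (take k ds))"

lemma marker_sum_take: "k \<le> length ds \<Longrightarrow> marker ds (sum_list (take k ds))"
  by (auto simp: marker_def)

context
  fixes ds :: "int list"
  assumes pos: "\<And>d. d \<in> set ds \<Longrightarrow> d > 0"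
begin

lemma sum_take_less:
  assumes "a < b" "b \<le> length ds"
  shows "sum_list (take a ds) < sum_list (take b ds)"
  using assms
proof (induction b)
  case (Suc b)
  have "sum_list (take (Suc b) ds) = sum_list (take b ds) + ds ! b"
    using Suc.prems by (simp add: take_Suc_conv_app_nth)
  moreover have "ds ! b > 0" using Suc.prems pos by simp
  ultimately show ?case using Suc by (cases "a = b") auto
qed simp

lemma sum_take_less_iff:
  "a \<le> length ds \<Longrightarrow> b \<le> length ds \<Longrightarrow> sum_list (take a ds) < sum_list (take b ds) \<longleftrightarrow> a < b"
  by (metis linorder_neqE_nat order_less_asym order_less_irrefl sum_take_less)

lemma sum_take_eq_iff:
  "a \<le> length ds \<Longrightarrow> b \<le> length ds \<Longrightarrow> sum_list (take a ds) = sum_list (take b ds) \<longleftrightarrow> a = b"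
  by (metis linorder_neqE_nat order_less_irrefl sum_take_less)

lemma gap_marker_iff:
  assumes "d > 0"
  shows "gap d (marker ds) p \<longleftrightarrow> (\<exists>k<length ds. p = sum_list (take k ds) \<and> d = ds ! k)"
proof
  assume g: "gap d (marker ds) p"
  then obtain a b where a: "a \<le> length ds" "p = sum_list (take a ds)"
    and b: "b \<le> length ds" "p + d = sum_list (take b ds)"
    by (auto simp: gap_def marker_def)
  have "a < b" using a b assms sum_take_less_iff[of a b] by linarith
  have "b = Suc a"
  proof (rule ccontr)
    assume "b \<noteq> Suc a"
    then have "p < sum_list (take (Suc a) ds)" "sum_list (take (Suc a) ds) < p + d"
      using a b \<open>a < b\<close> by (auto intro!: sum_take_less)
    moreover have "marker ds (sum_list (take (Suc a) ds))"
      using b \<open>a < b\<close> by (intro marker_sum_take) simp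
    ultimately show False using g by (auto simp: gap_def)
  qed
  then show "\<exists>k<length ds. p = sum_list (take k ds) \<and> d = ds ! k"
    using a b by (intro exI[of _ a]) (auto simp: take_Suc_conv_app_nth)
next
  assume "\<exists>k<length ds. p = sum_list (take k ds) \<and> d = ds ! k"
  then obtain k where k: "k < length ds" "p = sum_list (take k ds)" "d = ds ! k" by blast
  then have pd: "p + d = sum_list (take (Suc k) ds)" by (simp add: take_Suc_conv_app_nth)
  have "\<not> marker ds j" if "p < j" "j < p + d" for j
  proof
    assume "marker ds j"
    then obtain c where "c \<le> length ds" "j = sum_list (take c ds)" by (auto simp: marker_def)
    then show False using that k pd sum_take_less_iff[of k c] sum_take_less_iff[of c "Suc k"] by auto
  qed
  then show "gap d (marker ds) p"
    using k(1,2) pd marker_sum_take[of k ds] marker_sum_take[of "Suc k" ds] by (auto simp: gap_def)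
qed

text \<open>Adjacent gaps have lengths that are neighbours in \<open>ds\<close>, hence different, so
  every gap is isolated.\<close>

lemma isolated_gap_marker_iff:
  assumes "distinct_adj ds" "d > 0"
  shows "isolated_gap d (marker ds) p \<longleftrightarrow> (\<exists>k<length ds. p = sum_list (take k ds) \<and> d = ds ! k)"
proof -
  have adj: "ds ! k \<noteq> ds ! Suc k" if "Suc k < length ds" for k
    using assms(1) that by (simp add: distinct_adj_conv_nth)
  have "\<not> gap d (marker ds) (p - d) \<and> \<not> gap d (marker ds) (p + d)"
    if k: "k < length ds" "p = sum_list (take k ds)" "d = ds ! k" for k
  proof -
    have step: "sum_list (take j ds) + ds ! j = sum_list (take (Suc j) ds)" if "j < length ds" for j
      using that by (simp add: take_Suc_conv_app_nth)
    have "\<not> gap d (marker ds) (p + d)"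
    proof
      assume "gap d (marker ds) (p + d)"
      then obtain j where j: "j < length ds" "p + d = sum_list (take j ds)" "d = ds ! j"
        using gap_marker_iff[OF assms(2)] by blast
      then have "j = Suc k" using k step[of k] sum_take_eq_iff[of j "Suc k"] by auto
      then show False using adj[of k] j k by simp
    qed
    moreover have "\<not> gap d (marker ds) (p - d)"
    proof
      assume "gap d (marker ds) (p - d)"
      then obtain j where j: "j < length ds" "p - d = sum_list (take j ds)" "d = ds ! j"
        using gap_marker_iff[OF assms(2)] by blast
      then have "k = Suc j" using k step[of j] sum_take_eq_iff[of k "Suc j"] by auto
      then show False using adj[of j] j k by simp
    qed
    ultimately show ?thesis by simp
  qed
  then show ?thesis
    using assms(2) by (auto simp: isolated_gap_def gap_marker_iff)
qed

text \<open>Each letter moves the walker by at most one marker. It is \<open>length es\<close>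
  markers ahead only if every letter moved it forward, which forces the letters to be the first
  entries of \<open>ds\<close>.\<close>

lemma walk_marker:
  assumes "distinct_adj ds" and "\<And>e. e \<in> set es \<Longrightarrow> e > 0"
  shows "\<exists>k\<le>length ds. walk (marker ds) es 0 = sum_list (take k ds) \<and>
           (k < length es \<or> es = take k ds)"
  using assms(2)
proof (induction es rule: rev_induct)
  case Nil
  show ?case by (intro exI[of _ 0]) simp
next
  case (snoc e es)
  then obtain k where k: "k \<le> length ds" "walk (marker ds) es 0 = sum_list (take k ds)"
    "k < length es \<or> es = take k ds" by auto
  have e: "e > 0" using snoc.prems by simp
  have step: "sum_list (take j ds) + ds ! j = sum_list (take (Suc j) ds)" if "j < length ds" for j
    using that by (simp add: take_Suc_conv_app_nth)
  have walk: "walk (marker ds) (es @ [e]) 0 = gap_swap e (marker ds) (sum_list (take k ds))"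
    using k by (simp add: walk_append)
  consider (forward) "isolated_gap e (marker ds) (sum_list (take k ds))"
    | (backward) "\<not> isolated_gap e (marker ds) (sum_list (take k ds))"
        "isolated_gap e (marker ds) (sum_list (take k ds) - e)"
    | (stay) "\<not> isolated_gap e (marker ds) (sum_list (take k ds))"
        "\<not> isolated_gap e (marker ds) (sum_list (take k ds) - e)" by blast
  then show ?case
  proof cases
    case forward
    then have "k < length ds" "e = ds ! k"
      using k(1) e isolated_gap_marker_iff[OF assms(1)] sum_take_eq_iff by force+
    then show ?thesis
      unfolding walk using k forward step[of k]
      by (intro exI[of _ "Suc k"]) (auto simp: gap_swap_def take_Suc_conv_app_nth)
  next
    \<comment> \<open>A step back, like the rest in the next case, loses time, so the strict
      inequality holds from here on.\<close>
    case backward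
    then obtain j where j: "j < length ds" "sum_list (take k ds) - e = sum_list (take j ds)" "e = ds ! j"
      using e isolated_gap_marker_iff[OF assms(1)] by blast
    then have "k = Suc j" using step[of j] k(1) sum_take_eq_iff[of k "Suc j"] by auto
    then show ?thesis
      unfolding walk using k j backward by (intro exI[of _ j]) (auto simp: gap_swap_def)
  next
    case stay
    then show ?thesis
      unfolding walk using k by (intro exI[of _ k]) (auto simp: gap_swap_def)
  qed
qed

text \<open>With at most \<open>length ds\<close> letters there is no time to lose, so the dichotomy
  of \<open>walk_marker\<close> leaves only \<open>es = ds\<close>.\<close>

lemma walk_to_end:
  assumes "distinct_adj ds" "\<And>e. e \<in> set es \<Longrightarrow> e > 0" "length es \<le> length ds"
  shows "walk (marker ds) es 0 = sum_list ds \<longleftrightarrow> es = ds"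
proof
  assume "walk (marker ds) es 0 = sum_list ds"
  then obtain k where k: "k \<le> length ds" "sum_list (take k ds) = sum_list (take (length ds) ds)"
    "k < length es \<or> es = take k ds"
    using walk_marker[OF assms(1), of es] assms(2) by auto
  then have "k = length ds" using sum_take_eq_iff[of k "length ds"] by simp
  then show "es = ds" using k assms(3) by auto
next
  have "walk (marker ds) (take k ds) 0 = sum_list (take k ds)" if "k \<le> length ds" for k
    using that
  proof (induction k)
    case (Suc k)
    then have "isolated_gap (ds ! k) (marker ds) (sum_list (take k ds))"
      using isolated_gap_marker_iff[OF assms(1), of "ds ! k" "sum_list (take k ds)"]
        pos[of "ds ! k"] by (metis Suc_le_lessD nth_mem)
    then show ?case
      using Suc by (simp add: walk_append gap_swap_def take_Suc_conv_app_nth)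
  qed simp
  from this[of "length ds"] show "walk (marker ds) es 0 = sum_list ds" if "es = ds"
    using that by simp
qed

end

section \<open>Gap lengths that encode reduced words\<close>

text \<open>Each generator owns two positive gap lengths and acts as the product of the two swaps; a
  single swap would have its square trivial. Reversing the order inverts the product.\<close>

primrec spell :: "('g \<Rightarrow> nat) \<Rightarrow> 'g \<times> bool \<Rightarrow> int list" where
  "spell \<nu> (s, b) =
     (if b then [2 * int (\<nu> s) + 1, 2 * int (\<nu> s) + 2]
      else [2 * int (\<nu> s) + 2, 2 * int (\<nu> s) + 1])"

lemma spell_inj:
  assumes "inj_on \<nu> S" "fst l \<in> S" "fst m \<in> S" "spell \<nu> l = spell \<nu> m"
  shows "l = m"
proof -
  obtain s b t c where lm: "l = (s, b)" "m = (t, c)" by (cases l, cases m)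
  then have "\<nu> s = \<nu> t \<and> b = c"
    using assms(4) by (auto split: if_splits)
  then show ?thesis using assms lm by (auto dest: inj_onD)
qed

lemma length_spell [simp]: "length (spell \<nu> l) = 2"
  by (cases l) auto

lemma spell_not_Nil [simp]: "spell \<nu> l \<noteq> []"
  by (cases l) auto

lemma concat_spell_inj:
  assumes "inj_on \<nu> S" "set u \<subseteq> S \<times> UNIV" "set u' \<subseteq> S \<times> UNIV"
    and "concat (map (spell \<nu>) u) = concat (map (spell \<nu>) u')"
  shows "u = u'"
  using assms(2-)
proof (induction u arbitrary: u')
  case Nil
  then show ?case by (cases u') (auto simp del: spell.simps)
next
  case (Cons l u)
  then obtain m v where u': "u' = m # v" by (cases u') (auto simp del: spell.simps)
  then have "spell \<nu> l = spell \<nu> m" "concat (map (spell \<nu>) u) = concat (map (spell \<nu>) v)"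
    using Cons.prems(3) by auto
  moreover have "fst l \<in> S" "fst m \<in> S" using Cons.prems u' by auto
  ultimately have "l = m" "u = v"
    using spell_inj[OF assms(1), of l m] Cons.IH[of v] Cons.prems(1,2) u' by simp_all
  then show ?case using u' by simp
qed

text \<open>The two lengths of a letter differ. Equal lengths meet at the border of two letters only
  if the second is the inverse of the first, which a reduced word excludes.\<close>

lemma distinct_adj_concat_spell:
  assumes "inj_on \<nu> S" "set u \<subseteq> S \<times> UNIV" "reduced_word u"
  shows "distinct_adj (concat (map (spell \<nu>) u))"
  using assms(2,3)
proof (induction u)
  case (Cons l u)
  have IH: "distinct_adj (concat (map (spell \<nu>) u))"
    using Cons by (auto simp: reduced_word_def successively_Cons)
  obtain s b where l: "l = (s, b)" by (cases l)
  show ?case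
  proof (cases u)
    case Nil
    then show ?thesis by (simp add: l)
  next
    case (Cons m v)
    obtain t c where m: "m = (t, c)" by (cases m)
    have "s \<in> S" "t \<in> S" "\<not> (s = t \<and> b \<noteq> c)"
      using Cons.prems Cons l m by (auto simp: reduced_word_def)
    then have "last (spell \<nu> l) \<noteq> hd (spell \<nu> m)"
      using assms(1) by (auto simp: l m split: if_splits dest: inj_onD; presburger)
    then show ?thesis
      using IH by (auto simp: Cons distinct_adj_append_iff l m)
  qed
qed simp

lemma free_group_no_cancellation:
  fixes A :: "('a, 'k) monoid_scheme" and G :: "('g, 'm) monoid_scheme"
  assumes A: "comm_group A" "finite (carrier A)" and G: "group G"
    and basis: "free_basis G S" and "countable S"
  shows "\<exists>(\<Sigma> :: nat set) \<phi>. finite \<Sigma> \<and> card \<Sigma> \<ge> 2 \<and> \<phi> \<in> hom G (Aut_full_shift \<Sigma>) \<and>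
           \<not> has_cancellation G (full_shift \<Sigma>) \<phi> A"
proof -
  interpret A: comm_group A by fact
  interpret G: group G by fact
  obtain \<nu> :: "'g \<Rightarrow> nat" where \<nu>: "inj_on \<nu> S"
    using \<open>countable S\<close> by (auto simp: countable_def)
  define T :: "'g \<times> bool \<Rightarrow> (int \<Rightarrow> bool \<times> bool) \<Rightarrow> (int \<Rightarrow> bool \<times> bool)"
    where "T = (\<lambda>l. word_action swap_map (spell \<nu> l))"
  \<comment> \<open>The two inner swaps are equal and cancel, then so do the outer ones.\<close>
  have T: "T (s, b) \<circ> T (s, \<not> b) = id" for s b
    by (cases b) (simp_all add: T_def fun_eq_iff pointfree_idE[OF swap_map_involution])
  have act: "word_action T u = word_action swap_map (concat (map (spell \<nu>) u))" for u
    by (induction u) (simp_all add: T_def)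
  obtain r where r: "\<And>g. g \<in> carrier G \<Longrightarrow> set (r g) \<subseteq> S \<times> UNIV"
    "\<And>g. g \<in> carrier G \<Longrightarrow> reduced_word (r g)"
    "\<And>g. g \<in> carrier G \<Longrightarrow> word_eval G (r g) = g"
    and hom: "word_action T (r \<one>\<^bsub>G\<^esub>) = id"
      "\<And>g h. \<lbrakk>g \<in> carrier G; h \<in> carrier G\<rbrakk> \<Longrightarrow>
         word_action T (r (g \<otimes>\<^bsub>G\<^esub> h)) = word_action T (r g) \<circ> word_action T (r h)"
    using G.free_basis_action[OF basis, of T] T by metis
  define E where "E = (\<lambda>g. concat (map (spell \<nu>) (r g)))"
  have actE: "word_action T (r g) = word_action swap_map (E g)" for g
    by (simp add: act E_def)
  have E_pos: "e > 0" if "e \<in> set (E g)" for e g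
    using that by (auto simp: E_def split: if_splits)
  have E_inj: "g = h" if "g \<in> carrier G" "h \<in> carrier G" "E g = E h" for g h
    using concat_spell_inj[OF \<nu>, of "r g" "r h"] r that by (metis E_def)
  have E_adj: "distinct_adj (E g)" if "g \<in> carrier G" for g
    using distinct_adj_concat_spell[OF \<nu>] r that by (simp add: E_def)
  define v :: "bool \<times> bool \<Rightarrow> int" where "v = (\<lambda>s. of_bool (snd s))"
  show ?thesis
  proof (rule no_cancellationI[OF A G, where F = "\<lambda>g. word_action T (r g)" and v = v])
    show "card (UNIV :: (bool \<times> bool) set) \<ge> 2" by (simp add: card_UNIV_bool)
    show "cellular (word_action T (r g))" if "g \<in> carrier G" for g
    proof -
      have "cellular (word_action swap_map ds :: (int \<Rightarrow> bool \<times> bool) \<Rightarrow> _)" for ds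
        by (induction ds)
          (simp_all only: word_action_Nil word_action_Cons cellular_id cellular_comp cellular_swap_map)
      then show ?thesis by (simp add: act)
    qed
  next
    fix f assume f: "f \<in> carrier G \<rightarrow> carrier A"
      and fin: "finite {g \<in> carrier G. f g \<noteq> \<one>\<^bsub>A\<^esub>}"
      and ne: "{g \<in> carrier G. f g \<noteq> \<one>\<^bsub>A\<^esub>} \<noteq> {}"
    let ?S = "{g \<in> carrier G. f g \<noteq> \<one>\<^bsub>A\<^esub>}"
    have fA: "f \<in> ?S \<rightarrow> carrier A" using f by auto
    let ?N = "(\<lambda>h. length (E h)) ` ?S"
    \<comment> \<open>A longest word is taken because \<open>walk_to_end\<close> allows no more
      letters than the path has gaps.\<close>
    have "Max ?N \<in> ?N" using fin ne by (intro Max_in) auto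
    then obtain g where g: "g \<in> ?S" and "length (E g) = Max ?N" by auto
    then have max: "length (E h) \<le> length (E g)" if "h \<in> ?S" for h
      using fin that by simp
    \<comment> \<open>The markers spell \<open>g\<close>, and the only datum \<open>True\<close>
      sits at the far end of the path.\<close>
    define x where "x = (\<lambda>j. (marker (E g) j, j = sum_list (E g)))"
    have weight: "v (word_action T (r h) x 0) = of_bool (h = g)" if "h \<in> ?S" for h
    proof -
      have "fst \<circ> x = marker (E g)" by (auto simp: x_def)
      then have "snd (word_action T (r h) x 0) \<longleftrightarrow> E h = E g"
        using walk_to_end[of "E g" "E h"] E_pos E_adj g max[OF that]
        by (simp add: actE snd_word_action_swap_map x_def)
      then show ?thesis using E_inj[of h g] that g by (auto simp: v_def)
    qed
    have pow: "f h [^]\<^bsub>A\<^esub> v (word_action T (r h) x 0) = (if g = h then f h else \<one>\<^bsub>A\<^esub>)"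
      if "h \<in> ?S" for h
    proof -
      have "f h \<in> carrier A" using that fA by blast
      then show ?thesis using weight[OF that] by simp
    qed
    have fA': "(\<lambda>h. if g = h then f h else \<one>\<^bsub>A\<^esub>) \<in> ?S \<rightarrow> carrier A"
      using fA by (auto simp: Pi_def)
    have "finprod A (\<lambda>h. f h [^]\<^bsub>A\<^esub> v (word_action T (r h) x 0)) ?S =
        finprod A (\<lambda>h. if g = h then f h else \<one>\<^bsub>A\<^esub>) ?S"
      by (rule A.finprod_cong'[OF refl fA' pow])
    also have "\<dots> = f g"
      by (rule A.finprod_singleton[OF g fin fA])
    finally show "\<exists>x. finprod A (\<lambda>g. f g [^]\<^bsub>A\<^esub> v (word_action T (r g) x 0)) ?S \<noteq> \<one>\<^bsub>A\<^esub>"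
      using g by (intro exI[of _ x]) simp
  qed (use hom in auto)
qed

section \<open>Free abelian groups\<close>

definition int_iterate :: "('x \<Rightarrow> 'x) \<Rightarrow> ('x \<Rightarrow> 'x) \<Rightarrow> int \<Rightarrow> 'x \<Rightarrow> 'x" where
  "int_iterate f f' k = (if k \<ge> 0 then f ^^ nat k else f' ^^ nat (- k))"

lemma int_iterate_0 [simp]: "int_iterate f f' 0 = id"
  by (simp add: int_iterate_def)

lemma int_iterate_1 [simp]: "int_iterate f f' 1 = f"
  by (simp add: int_iterate_def)

lemma int_iterate_minus_1 [simp]: "int_iterate f f' (- 1) = f'"
  by (simp add: int_iterate_def)

lemma int_iterate_add_1:
  assumes "f \<circ> f' = id"
  shows "int_iterate f f' (k + 1) = f \<circ> int_iterate f f' k"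
proof (cases "k \<ge> 0")
  case True
  then show ?thesis by (simp add: int_iterate_def nat_add_distrib)
next
  case False
  then have "nat (- k) = Suc (nat (- (k + 1)))" by linarith
  then have "f \<circ> f' ^^ nat (- k) = f' ^^ nat (- (k + 1))"
    using assms by (simp add: o_assoc)
  then show ?thesis using False by (auto simp: int_iterate_def)
qed

lemma int_iterate_diff_1:
  assumes "f' \<circ> f = id" "f \<circ> f' = id"
  shows "int_iterate f f' (k - 1) = f' \<circ> int_iterate f f' k"
  using int_iterate_add_1[OF assms(2), of "k - 1"] assms(1) by (simp add: o_assoc)

lemma int_iterate_add:
  assumes "f' \<circ> f = id" "f \<circ> f' = id"
  shows "int_iterate f f' (k + l) = int_iterate f f' k \<circ> int_iterate f f' l"
proof (induction k rule: int_induct[where k = 0])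
  case (step1 i)
  have "int_iterate f f' (i + 1 + l) = f \<circ> int_iterate f f' (i + l)"
    using int_iterate_add_1[OF assms(2), of "i + l"] by (simp add: add_ac)
  then show ?case by (simp add: step1(2) int_iterate_add_1[OF assms(2)] o_assoc)
next
  case (step2 i)
  have "int_iterate f f' (i - 1 + l) = f' \<circ> int_iterate f f' (i + l)"
    using int_iterate_diff_1[OF assms, of "i + l"] by (simp add: algebra_simps)
  then show ?case by (simp add: step2(2) int_iterate_diff_1[OF assms] o_assoc)
qed simp

lemma int_iterate_invariant:
  assumes "\<And>c. P c \<Longrightarrow> P (f c)" "\<And>c. P c \<Longrightarrow> P (f' c)" "P c"
  shows "P (int_iterate f f' k c)"
proof -
  have "P ((g ^^ n) c)" if "\<And>c. P c \<Longrightarrow> P (g c)" for g n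
    using that assms(3) by (induction n) auto
  then show ?thesis using assms(1,2) by (auto simp: int_iterate_def)
qed

section \<open>Labels and belts\<close>

text \<open>As a least exponent, the label of a position is unique, which keeps belts of different
  labels disjoint. A position may have no label.\<close>

definition labelled :: "nat \<Rightarrow> (int \<Rightarrow> bool) \<Rightarrow> int \<Rightarrow> bool" where
  "labelled i w j \<longleftrightarrow> w (j + 2 ^ i) \<and> (\<forall>m<i. \<not> w (j + 2 ^ m))"

lemma labelled_unique: "labelled i w j \<Longrightarrow> labelled i' w j \<Longrightarrow> i = i'"
  by (metis labelled_def linorder_neqE_nat)

text \<open>A cell is a position together with one of two data tracks, on which data move in opposite
  directions. At the end of a stretch of label \<open>i\<close> the motion is reflected into the other track,
  which keeps it bijective on every configuration. The stride is the spacing of the positions of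
  label \<open>i\<close> on the paperfolding sequence, which are the odd multiples of \<open>2 ^ (i + 1)\<close>.\<close>

definition belt_step :: "nat \<Rightarrow> (int \<Rightarrow> bool) \<Rightarrow> int \<times> bool \<Rightarrow> int \<times> bool" where
  "belt_step i w = (\<lambda>(j, s).
     if \<not> labelled i w j then (j, s)
     else if s then if labelled i w (j + 2 ^ (i + 2)) then (j + 2 ^ (i + 2), True) else (j, False)
     else if labelled i w (j - 2 ^ (i + 2)) then (j - 2 ^ (i + 2), False) else (j, True))"

text \<open>Time reversal: exchanging the two tracks conjugates the step to its inverse.\<close>

definition belt_back :: "nat \<Rightarrow> (int \<Rightarrow> bool) \<Rightarrow> int \<times> bool \<Rightarrow> int \<times> bool" where
  "belt_back i w = apsnd Not \<circ> belt_step i w \<circ> apsnd Not"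

lemma belt_step_back: "belt_step i w \<circ> belt_back i w = id"
  by (auto simp: belt_step_def belt_back_def fun_eq_iff)

lemma belt_back_step: "belt_back i w \<circ> belt_step i w = id"
  by (auto simp: belt_step_def belt_back_def fun_eq_iff)

abbreviation belt :: "nat \<Rightarrow> (int \<Rightarrow> bool) \<Rightarrow> int \<Rightarrow> int \<times> bool \<Rightarrow> int \<times> bool" where
  "belt i w \<equiv> int_iterate (belt_step i w) (belt_back i w)"

lemma belt_add: "belt i w (k + l) = belt i w k \<circ> belt i w l"
  by (rule int_iterate_add[OF belt_back_step belt_step_back])

lemma labelled_belt:
  assumes "labelled i w (fst c)"
  shows "labelled i w (fst (belt i w k c))"
  using assms
  by (intro int_iterate_invariant[of "\<lambda>c. labelled i w (fst c)"])
     (auto simp: belt_step_def belt_back_def split: prod.splits)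

lemma belt_unlabelled:
  assumes "\<not> labelled i w (fst c)"
  shows "belt i w k c = c"
  using assms
  by (intro int_iterate_invariant[of "\<lambda>d. d = c"])
     (auto simp: belt_step_def belt_back_def split: prod.splits)

definition move :: "(nat \<Rightarrow> int) \<Rightarrow> (int \<Rightarrow> bool) \<Rightarrow> int \<times> bool \<Rightarrow> int \<times> bool" where
  "move \<kappa> w c =
     (if \<exists>i. labelled i w (fst c)
      then let i = (THE i. labelled i w (fst c)) in belt i w (\<kappa> i) c else c)"

lemma move_labelled:
  assumes "labelled i w (fst c)"
  shows "move \<kappa> w c = belt i w (\<kappa> i) c"
proof -
  have "(THE i. labelled i w (fst c)) = i"
    using assms labelled_unique by blast
  then show ?thesis using assms by (auto simp: move_def Let_def)
qed

text \<open>Motion along a belt preserves the label, so both moves take place on the same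
  belt.\<close>

lemma move_add: "move (\<lambda>n. \<kappa> n + \<mu> n) w c = move \<mu> w (move \<kappa> w c)"
proof (cases "\<exists>i. labelled i w (fst c)")
  case True
  then obtain i where i: "labelled i w (fst c)" by blast
  then have "labelled i w (fst (belt i w (\<kappa> i) c))" by (rule labelled_belt)
  then show ?thesis
    using i belt_add[of i w "\<mu> i" "\<kappa> i"] by (simp add: move_labelled add.commute)
qed (simp add: move_def)

section \<open>Transport of data and the formal sum\<close>

type_synonym 'h cell = "bool \<times> (bool \<Rightarrow> 'h) \<times> 'h"

definition datum :: "(int \<Rightarrow> 'h cell) \<Rightarrow> int \<times> bool \<Rightarrow> 'h" where
  "datum x c = fst (snd (x (fst c))) (snd c)"

text \<open>Data are pulled back along \<open>move\<close>. The last component stands for the formal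
  sum over all \<open>n\<close> of the data at the reference cells
  \<open>(j + 2 ^ (n + 1), True)\<close>; only its change is computed, with finitely many terms if
  \<open>\<kappa>\<close> has finite support. A reference cell without label \<open>n\<close> stays
  put and contributes zero.\<close>

definition transport :: "(nat \<Rightarrow> int) \<Rightarrow> (int \<Rightarrow> 'h::ab_group_add cell) \<Rightarrow> int \<Rightarrow> 'h cell" where
  "transport \<kappa> x = (\<lambda>j.
     (fst (x j), (\<lambda>s. datum x (move \<kappa> (fst \<circ> x) (j, s))),
      snd (snd (x j)) +
        (\<Sum>n | \<kappa> n \<noteq> 0. datum x (belt n (fst \<circ> x) (\<kappa> n) (j + 2 ^ (n + 1), True)) -
                        datum x (j + 2 ^ (n + 1), True))))"

lemma fst_transport: "fst \<circ> transport \<kappa> x = fst \<circ> x"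
  by (auto simp: transport_def)

lemma datum_transport: "datum (transport \<kappa> x) c = datum x (move \<kappa> (fst \<circ> x) c)"
  by (simp add: transport_def datum_def)

lemma transport_sum:
  assumes "finite N" "{n. \<kappa> n \<noteq> 0} \<subseteq> N"
  shows "snd (snd (transport \<kappa> x j)) = snd (snd (x j)) +
    (\<Sum>n\<in>N. datum x (belt n (fst \<circ> x) (\<kappa> n) (j + 2 ^ (n + 1), True)) - datum x (j + 2 ^ (n + 1), True))"
proof -
  have "(\<Sum>n | \<kappa> n \<noteq> 0. datum x (belt n (fst \<circ> x) (\<kappa> n) (j + 2 ^ (n + 1), True)) -
            datum x (j + 2 ^ (n + 1), True)) =
        (\<Sum>n\<in>N. datum x (belt n (fst \<circ> x) (\<kappa> n) (j + 2 ^ (n + 1), True)) -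
            datum x (j + 2 ^ (n + 1), True))"
    using assms by (intro sum.mono_neutral_left) auto
  then show ?thesis by (simp add: transport_def)
qed

lemma transport_zero: "transport (\<lambda>_. 0) = id"
proof -
  have "move (\<lambda>_. 0) w c = c" for w c by (simp add: move_def)
  then show ?thesis by (auto simp: fun_eq_iff transport_def datum_def)
qed

text \<open>The change of the formal sum is a cocycle: the differences made by \<open>\<mu>\<close>
  on \<open>x\<close> and by \<open>\<kappa>\<close> on the result telescope, because the belts
  depend only on the marks, which stay fixed.\<close>

lemma transport_add:
  fixes \<kappa> \<mu> :: "nat \<Rightarrow> int"
  assumes fin: "finite {n. \<kappa> n \<noteq> 0}" "finite {n. \<mu> n \<noteq> 0}"
  shows "transport (\<lambda>n. \<kappa> n + \<mu> n) = transport \<kappa> \<circ> transport \<mu>"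
proof
  fix x :: "int \<Rightarrow> 'h::ab_group_add cell"
  \<comment> \<open>The common finite index set \<open>?N\<close> lets the three sums be compared
    term by term; the added terms vanish.\<close>
  let ?w = "fst \<circ> x" and ?y = "transport \<mu> x" and ?N = "{n. \<kappa> n \<noteq> 0} \<union> {n. \<mu> n \<noteq> 0}"
  have summand: "datum x (belt n ?w (\<kappa> n + \<mu> n) (j, True)) - datum x (j, True) =
      (datum x (belt n ?w (\<mu> n) (j, True)) - datum x (j, True)) +
      (datum ?y (belt n ?w (\<kappa> n) (j, True)) - datum ?y (j, True))" for n j
  proof (cases "labelled n ?w j")
    case True
    then have "labelled n ?w (fst (belt n ?w (\<kappa> n) (j, True)))" by (simp add: labelled_belt)
    then show ?thesis
      using True belt_add[of n ?w "\<mu> n" "\<kappa> n"]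
      by (simp add: datum_transport move_labelled add.commute)
  next
    case False
    then show ?thesis by (simp add: belt_unlabelled)
  qed
  have "snd (snd (transport (\<lambda>n. \<kappa> n + \<mu> n) x j)) = snd (snd (transport \<kappa> ?y j))" for j
  proof -
    have "snd (snd (transport (\<lambda>n. \<kappa> n + \<mu> n) x j)) = snd (snd (x j)) +
        (\<Sum>n\<in>?N. datum x (belt n ?w (\<kappa> n + \<mu> n) (j + 2 ^ (n + 1), True)) -
           datum x (j + 2 ^ (n + 1), True))"
      using fin by (intro transport_sum) auto
    also have "\<dots> = snd (snd (x j)) +
        (\<Sum>n\<in>?N. datum x (belt n ?w (\<mu> n) (j + 2 ^ (n + 1), True)) -
           datum x (j + 2 ^ (n + 1), True)) +
        (\<Sum>n\<in>?N. datum ?y (belt n ?w (\<kappa> n) (j + 2 ^ (n + 1), True)) -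
           datum ?y (j + 2 ^ (n + 1), True))"
      by (simp only: summand sum.distrib add.assoc)
    also have "\<dots> = snd (snd (?y j)) +
        (\<Sum>n\<in>?N. datum ?y (belt n (fst \<circ> ?y) (\<kappa> n) (j + 2 ^ (n + 1), True)) -
           datum ?y (j + 2 ^ (n + 1), True))"
      using fin transport_sum[of ?N \<mu> x j] by (simp only: fst_transport) auto
    also have "\<dots> = snd (snd (transport \<kappa> ?y j))"
      using fin by (intro transport_sum[symmetric]) auto
    finally show ?thesis .
  qed
  moreover have "fst (snd (transport (\<lambda>n. \<kappa> n + \<mu> n) x j)) = fst (snd (transport \<kappa> ?y j))" for j
  proof
    fix s
    have "fst (snd (transport (\<lambda>n. \<kappa> n + \<mu> n) x j)) s = datum (transport (\<lambda>n. \<kappa> n + \<mu> n) x) (j, s)"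
      by (simp add: datum_def)
    also have "\<dots> = datum (transport \<kappa> ?y) (j, s)"
      by (simp only: datum_transport move_add fst_transport)
    finally show "fst (snd (transport (\<lambda>n. \<kappa> n + \<mu> n) x j)) s = fst (snd (transport \<kappa> ?y j)) s"
      by (simp add: datum_def)
  qed
  moreover have "fst (transport (\<lambda>n. \<kappa> n + \<mu> n) x j) = fst (transport \<kappa> ?y j)" for j
    by (simp add: transport_def)
  ultimately show "transport (\<lambda>n. \<kappa> n + \<mu> n) x = (transport \<kappa> \<circ> transport \<mu>) x"
    by (auto simp: prod_eq_iff)
qed

definition single :: "nat \<Rightarrow> int \<Rightarrow> nat \<Rightarrow> int" where
  "single n m = (\<lambda>i. if i = n then m else 0)"

lemma transport_single:
  "transport (single n m) x = (\<lambda>j.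
     (fst (x j), (\<lambda>s. datum x (belt n (fst \<circ> x) m (j, s))),
      snd (snd (x j)) + (datum x (belt n (fst \<circ> x) m (j + 2 ^ (n + 1), True)) -
                         datum x (j + 2 ^ (n + 1), True))))"
proof -
  have move: "move (single n m) w c = belt n w m c" for w c
  proof (cases "labelled n w (fst c)")
    case True
    then show ?thesis by (simp add: move_labelled single_def)
  next
    case False
    then have "move (single n m) w c = c"
      using labelled_unique[of _ w "fst c"]
      by (cases "\<exists>i. labelled i w (fst c)") (auto simp: move_labelled single_def, simp add: move_def)
    then show ?thesis using False by (simp add: belt_unlabelled)
  qed
  have sub: "{i. single n m i \<noteq> 0} \<subseteq> {n}" by (auto simp: single_def)
  have single: "single n m n = m" by (simp add: single_def)
  have total: "snd (snd (transport (single n m) x j)) =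
      snd (snd (x j)) + (datum x (belt n (fst \<circ> x) m (j + 2 ^ (n + 1), True)) -
        datum x (j + 2 ^ (n + 1), True))" for j
    using transport_sum[OF _ sub, of x j] single by simp
  show ?thesis
    by (rule ext, intro prod_eqI)
       (simp_all only: total fst_conv snd_conv, simp_all add: transport_def move)
qed

section \<open>Locality of transport\<close>

lemma labelled_cong:
  assumes "\<And>i. \<bar>i\<bar> \<le> \<bar>j\<bar> + 2 ^ n \<Longrightarrow> w i = w' i"
  shows "labelled n w j = labelled n w' j"
proof -
  have "w (j + 2 ^ m) = w' (j + 2 ^ m)" if "m \<le> n" for m
  proof (rule assms)
    have "(2::int) ^ m \<le> 2 ^ n" using that by (simp add: power_increasing)
    then show "\<bar>j + 2 ^ m\<bar> \<le> \<bar>j\<bar> + 2 ^ n" using abs_triangle_ineq[of j "2 ^ m"]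
      by (simp only: abs_of_nonneg zero_le_power zero_le_numeral)
  qed
  then show ?thesis by (auto simp: labelled_def)
qed

text \<open>The new symbol at \<open>0\<close> depends on \<open>T\<close> only at the cells over
  \<open>0\<close> and over the reference position \<open>a\<close>, so locality of \<open>T\<close>
  is asked there; equivariance covers all other positions.\<close>

lemma cellular_transport_generator:
  fixes T :: "(int \<Rightarrow> bool) \<Rightarrow> int \<times> bool \<Rightarrow> int \<times> bool"
  assumes T_shift: "\<And>w c. apfst (\<lambda>j. j + 1) (T (\<lambda>i. w (i + 1)) c) = T w (apfst (\<lambda>j. j + 1) c)"
    and T_cong: "\<And>w w' c. \<lbrakk>\<And>i. \<bar>i\<bar> \<le> R \<Longrightarrow> w i = w' i; fst c \<in> {0, a}\<rbrakk> \<Longrightarrow> T w c = T w' c"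
    and T_bound: "\<And>w c. fst c \<in> {0, a} \<Longrightarrow> \<bar>fst (T w c)\<bar> \<le> R" and a: "\<bar>a\<bar> \<le> R"
  shows "cellular (\<lambda>(x :: int \<Rightarrow> 'h::ab_group_add cell) j.
     (fst (x j), (\<lambda>s. datum x (T (fst \<circ> x) (j, s))),
      snd (snd (x j)) + (datum x (T (fst \<circ> x) (j + a, True)) - datum x (j + a, True))))"
    (is "cellular ?F")
proof -
  have "?F (shift x) = shift (?F x)" for x :: "int \<Rightarrow> 'h cell"
  proof -
    have base: "fst \<circ> shift x = (\<lambda>i. (fst \<circ> x) (i + 1))" by (auto simp: shift_def)
    have datum: "datum (shift x) c = datum x (apfst (\<lambda>j. j + 1) c)" for c
      by (cases c) (simp add: datum_def shift_def)
    have "datum (shift x) (T (fst \<circ> shift x) (j, s)) = datum x (T (fst \<circ> x) (j + 1, s))" for j s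
      unfolding datum base T_shift by simp
    moreover have "datum (shift x) (j, s) = datum x (j + 1, s)" for j s
      by (simp add: datum)
    ultimately have "?F (shift x) j = shift (?F x) j" for j
      unfolding shift_def[of "?F x"] by (simp add: add_ac) (simp add: shift_def add_ac)
    then show ?thesis by blast
  qed
  moreover have "?F x 0 = ?F y 0" if agree: "\<forall>i\<in>{-R..R}. x i = y i" for x y :: "int \<Rightarrow> 'h cell"
  proof -
    have xy: "x i = y i" if "\<bar>i\<bar> \<le> R" for i
      using that by (intro bspec[OF agree]) (simp add: abs_le_iff)
    then have T: "T (fst \<circ> x) c = T (fst \<circ> y) c" if "fst c \<in> {0, a}" for c
      using that by (intro T_cong) auto
    have "datum x c = datum y c" if "\<bar>fst c\<bar> \<le> R" for c
      using xy[OF that] by (simp add: datum_def)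
    then show ?thesis
      using T_bound T xy[of 0] a by simp
  qed
  ultimately show ?thesis
    unfolding cellular_def by (intro conjI exI[of _ "{-R..R}"]) auto
qed

lemma cellular_transport_single_unit:
  assumes "m = 1 \<or> m = - 1"
  shows "cellular (transport (single n m) :: (int \<Rightarrow> 'h::ab_group_add cell) \<Rightarrow> _)"
proof -
  have lab_shift: "labelled n (\<lambda>i. w (i + 1)) j = labelled n w (j + 1)" for w j
    by (simp add: labelled_def add_ac)
  have p: "(2::int) ^ (n + 1) = 2 * 2 ^ n" "(2::int) ^ (n + 2) = 4 * 2 ^ n"
    "(2::int) ^ (n + 3) = 8 * 2 ^ n" "(0::int) < 2 ^ n"
    by (simp_all add: power_add)
  \<comment> \<open>In units of \<open>2 ^ n\<close>, the reference cell is at \<open>2\<close>, a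
    stride leads at most to \<open>6\<close>, and testing a label looks \<open>1\<close> further;
    radius \<open>8\<close> is enough.\<close>
  have lab_cong: "labelled n w j = labelled n w' j"
    if "\<And>i. \<bar>i\<bar> \<le> 2 ^ (n + 3) \<Longrightarrow> w i = w' i" "\<bar>j\<bar> \<le> 7 * 2 ^ n" for w w' j
    using that p by (intro labelled_cong) auto
  have step: "belt_step n w c = belt_step n w' c"
    if w: "\<And>i. \<bar>i\<bar> \<le> 2 ^ (n + 3) \<Longrightarrow> w i = w' i" and c: "fst c \<in> {0, 2 ^ (n + 1)}" for w w' c
  proof -
    have "labelled n w (fst c + d) = labelled n w' (fst c + d)"
      if "d \<in> {0, 2 ^ (n + 2), - (2 ^ (n + 2))}" for d
      using that c p(4) by (intro lab_cong[OF w]) (auto simp: p)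
    from this[of 0] this[of "2 ^ (n + 2)"] this[of "- (2 ^ (n + 2))"]
    have "labelled n w (fst c) = labelled n w' (fst c)"
      "labelled n w (fst c + 2 ^ (n + 2)) = labelled n w' (fst c + 2 ^ (n + 2))"
      "labelled n w (fst c - 2 ^ (n + 2)) = labelled n w' (fst c - 2 ^ (n + 2))"
      by simp_all
    then show ?thesis by (cases c) (simp add: belt_step_def)
  qed
  have bound: "\<bar>fst (belt_step n w c)\<bar> \<le> 2 ^ (n + 3)" if "fst c \<in> {0, 2 ^ (n + 1)}" for w c
    using that p by (auto simp: belt_step_def split: prod.splits)
  consider "m = 1" | "m = - 1" using assms by blast
  then have "cellular (\<lambda>(x :: int \<Rightarrow> 'h cell) j.
     (fst (x j), (\<lambda>s. datum x (belt n (fst \<circ> x) m (j, s))),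
      snd (snd (x j)) + (datum x (belt n (fst \<circ> x) m (j + 2 ^ (n + 1), True)) -
                         datum x (j + 2 ^ (n + 1), True))))"
  proof cases
    case 1
    show ?thesis
    proof (rule cellular_transport_generator[where R = "2 ^ (n + 3)"])
      show "apfst (\<lambda>j. j + 1) (belt n (\<lambda>i. w (i + 1)) m c) = belt n w m (apfst (\<lambda>j. j + 1) c)" for w c
        by (cases c) (simp add: 1 belt_step_def lab_shift algebra_simps)
      show "belt n w m c = belt n w' m c"
        if "\<And>i. \<bar>i\<bar> \<le> 2 ^ (n + 3) \<Longrightarrow> w i = w' i" "fst c \<in> {0, 2 ^ (n + 1)}" for w w' c
        using step[OF that] by (simp add: 1)
      show "\<bar>fst (belt n w m c)\<bar> \<le> 2 ^ (n + 3)" if "fst c \<in> {0, 2 ^ (n + 1)}" for w c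
        using bound[OF that] by (simp add: 1)
    qed (simp add: p)
  next
    case 2
    show ?thesis
    proof (rule cellular_transport_generator[where R = "2 ^ (n + 3)"])
      show "apfst (\<lambda>j. j + 1) (belt n (\<lambda>i. w (i + 1)) m c) = belt n w m (apfst (\<lambda>j. j + 1) c)" for w c
        by (cases c) (simp add: 2 belt_back_def belt_step_def lab_shift algebra_simps)
      show "belt n w m c = belt n w' m c"
        if "\<And>i. \<bar>i\<bar> \<le> 2 ^ (n + 3) \<Longrightarrow> w i = w' i" "fst c \<in> {0, 2 ^ (n + 1)}" for w w' c
        using step[OF that(1), where c = "apsnd Not c"] that(2) by (simp add: 2 belt_back_def)
      show "\<bar>fst (belt n w m c)\<bar> \<le> 2 ^ (n + 3)" if "fst c \<in> {0, 2 ^ (n + 1)}" for w c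
        using bound[of "apsnd Not c" w] that by (simp add: 2 belt_back_def)
    qed (simp add: p)
  qed
  moreover have "transport (single n m) = (\<lambda>(x :: int \<Rightarrow> 'h cell) j.
     (fst (x j), (\<lambda>s. datum x (belt n (fst \<circ> x) m (j, s))),
      snd (snd (x j)) + (datum x (belt n (fst \<circ> x) m (j + 2 ^ (n + 1), True)) -
                         datum x (j + 2 ^ (n + 1), True))))"
    by (rule ext) (rule transport_single)
  ultimately show ?thesis by simp
qed

text \<open>By \<open>transport_add\<close> it suffices to treat a unit step on one belt: these
  compose to any number of steps on it, and finitely many belts make up
  \<open>\<kappa>\<close>.\<close>

lemma cellular_transport:
  assumes "finite {n. \<kappa> n \<noteq> 0}"
  shows "cellular (transport \<kappa> :: (int \<Rightarrow> 'h::ab_group_add cell) \<Rightarrow> _)"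
proof -
  have fin: "finite {i. single n m i \<noteq> 0}" for n m
    by (rule finite_subset[of _ "{n}"]) (auto simp: single_def)
  have single: "cellular (transport (single n m) :: (int \<Rightarrow> 'h cell) \<Rightarrow> _)" for n m
  proof (induction m rule: int_induct[where k = 0])
    case base
    have "single n 0 = (\<lambda>_. 0)" by (auto simp: single_def)
    then show ?case by (simp only: transport_zero cellular_id)
  next
    case (step1 i)
    have split: "single n (i + 1) = (\<lambda>j. single n i j + single n 1 j)" by (auto simp: single_def)
    show ?case
      unfolding split transport_add[OF fin fin]
      by (intro cellular_comp[OF step1(2)] cellular_transport_single_unit) simp
  next
    case (step2 i)
    have split: "single n (i - 1) = (\<lambda>j. single n i j + single n (- 1) j)" by (auto simp: single_def)
    show ?case
      unfolding split transport_add[OF fin fin]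
      by (intro cellular_comp[OF step2(2)] cellular_transport_single_unit) simp
  qed
  have "cellular (transport \<kappa> :: (int \<Rightarrow> 'h cell) \<Rightarrow> _)" if "finite N" "{n. \<kappa> n \<noteq> 0} \<subseteq> N" for N \<kappa>
    using that
  proof (induction N arbitrary: \<kappa>)
    case empty
    then have "\<kappa> = (\<lambda>_. 0)" by auto
    then show ?case by (simp only: transport_zero cellular_id)
  next
    case (insert n N)
    let ?\<kappa> = "\<kappa>(n := 0)"
    have sub: "{n. ?\<kappa> n \<noteq> 0} \<subseteq> N" using insert.prems by auto
    have "\<kappa> = (\<lambda>i. ?\<kappa> i + single n (\<kappa> n) i)" by (auto simp: single_def)
    then have "transport \<kappa> = (transport ?\<kappa> \<circ> transport (single n (\<kappa> n)) :: (int \<Rightarrow> 'h cell) \<Rightarrow> _)"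
      using transport_add[OF finite_subset[OF sub insert.hyps(1)] fin[of n "\<kappa> n"]] by metis
    then show ?case using insert.IH[OF sub] single cellular_comp by metis
  qed
  then show ?thesis using assms by blast
qed

section \<open>Belts on the paperfolding sequence\<close>

text \<open>The regular paperfolding sequence on all integers: the odd part modulo \<open>4\<close>
  decides, and \<open>0\<close> gets the value \<open>False\<close>.\<close>

definition paperfolding :: "int \<Rightarrow> bool" where
  "paperfolding n \<longleftrightarrow> (\<exists>a o1. n = 2 ^ a * o1 \<and> o1 mod 4 = 3)"

lemma odd_part_unique:
  fixes o1 o2 :: int
  assumes "2 ^ a * o1 = 2 ^ b * o2" "odd o1" "odd o2"
  shows "a = b \<and> o1 = o2"
proof -
  have less: False if "a < b" "2 ^ a * o1 = 2 ^ b * o2" "odd o1" for a b and o1 o2 :: int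
  proof -
    obtain c where "b = a + Suc c" using \<open>a < b\<close> less_imp_Suc_add by fastforce
    then have "2 ^ a * o1 = 2 ^ a * (2 * 2 ^ c * o2)" using that(2) by (simp add: power_add)
    then show False using that(3) by simp
  qed
  then have "a = b" using assms by (metis linorder_neqE_nat)
  then show ?thesis using assms(1) by simp
qed

lemma paperfolding_iff:
  assumes "odd o1"
  shows "paperfolding (2 ^ a * o1) \<longleftrightarrow> o1 mod 4 = 3"
proof
  assume "paperfolding (2 ^ a * o1)"
  then obtain b o2 where b: "2 ^ a * o1 = 2 ^ b * o2" "o2 mod 4 = 3" by (auto simp: paperfolding_def)
  moreover have "odd o2" using b(2) by presburger
  ultimately show "o1 mod 4 = 3" using odd_part_unique assms by metis
qed (auto simp: paperfolding_def)

definition belt_site :: "nat \<Rightarrow> int \<Rightarrow> int" where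
  "belt_site i m = 2 ^ (i + 1) * (2 * m + 1)"

lemma belt_site_inj: "belt_site i m = belt_site j l \<Longrightarrow> i = j \<and> m = l"
  using odd_part_unique[of "i + 1" "2 * m + 1" "j + 1" "2 * l + 1"] by (simp add: belt_site_def)

text \<open>Adding \<open>2 ^ i\<close> to the site gives the odd part \<open>4 * m + 3\<close>,
  while adding a smaller power of two gives an odd part that is \<open>1\<close> modulo
  \<open>4\<close>.\<close>

lemma labelled_paperfolding: "labelled i paperfolding (belt_site i m)"
proof -
  have "belt_site i m + 2 ^ i = 2 ^ i * (4 * m + 3)"
    by (simp add: belt_site_def algebra_simps)
  moreover have "odd (4 * m + 3)" "(4 * m + 3) mod 4 = 3" by presburger+
  ultimately have "paperfolding (belt_site i m + 2 ^ i)" using paperfolding_iff by metis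
  moreover have "\<not> paperfolding (belt_site i m + 2 ^ k)" if "k < i" for k
  proof -
    obtain c where c: "i = k + Suc c" using \<open>k < i\<close> less_imp_Suc_add by fastforce
    let ?o = "4 * (2 ^ c * (2 * m + 1)) + 1"
    have "belt_site i m + 2 ^ k = 2 ^ k * ?o"
      by (simp add: belt_site_def c power_add algebra_simps)
    moreover have "odd ?o" "?o mod 4 \<noteq> 3" by presburger+
    ultimately show ?thesis using paperfolding_iff by metis
  qed
  ultimately show ?thesis by (auto simp: labelled_def)
qed

text \<open>The sites of a belt follow each other at the distance of one stride, without end on
  either side, so no reflection ever occurs.\<close>

lemma belt_paperfolding: "belt i paperfolding k (belt_site i m, True) = (belt_site i (m + k), True)"
proof -
  have site: "belt_site i m + 2 ^ (i + 2) = belt_site i (m + 1)"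
    "belt_site i m - 2 ^ (i + 2) = belt_site i (m - 1)" for m
    by (simp_all add: belt_site_def algebra_simps)
  have step: "belt_step i paperfolding (belt_site i m, True) = (belt_site i (m + 1), True)" for m
    using labelled_paperfolding[of i m] labelled_paperfolding[of i "m + 1"]
    by (simp only: belt_step_def split site) simp
  have backward: "belt_back i paperfolding (belt_site i m, True) = (belt_site i (m - 1), True)" for m
    using labelled_paperfolding[of i m] labelled_paperfolding[of i "m - 1"]
    by (simp only: belt_back_def belt_step_def split site o_apply apsnd_conv) simp
  show ?thesis
  proof (induction k rule: int_induct[where k = 0])
    case (step1 k)
    then show ?case
      by (simp only: int_iterate_add_1[OF belt_step_back] o_apply step add.assoc)
  next
    case (step2 k)
    then show ?case
      by (simp only: int_iterate_diff_1[OF belt_back_step belt_step_back] o_apply backward add_diff_eq)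
  qed simp
qed

text \<open>Seen from position \<open>0\<close>, the reference cells are the sites
  \<open>belt_site n 0\<close>, so each belt contributes one term that depends on
  \<open>\<kappa>\<close> and one that does not.\<close>

lemma transport_paperfolding:
  fixes b :: "int \<Rightarrow> 'h::ab_group_add"
  assumes "finite N" "{n. \<kappa> n \<noteq> 0} \<subseteq> N"
  shows "snd (snd (transport \<kappa> (\<lambda>j. (paperfolding j, \<lambda>_. b j, z)) 0)) =
    z - (\<Sum>n\<in>N. b (belt_site n 0)) + (\<Sum>n\<in>N. b (belt_site n (\<kappa> n)))"
proof -
  let ?x = "\<lambda>j. (paperfolding j, (\<lambda>_ :: bool. b j), z)"
  have "fst \<circ> ?x = paperfolding" by auto
  moreover have "0 + 2 ^ (n + 1) = belt_site n 0" for n by (simp add: belt_site_def)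
  ultimately show ?thesis
    using transport_sum[OF assms, of ?x 0]
    by (simp only: belt_paperfolding) (simp add: datum_def sum_subtractf)
qed

text \<open>Since \<open>\<omega> - 1 = \<omega>\<^sup>2\<close> for a primitive sixth root of unity \<open>\<omega>\<close>, there is an
  integer weight on \<open>\<int>/6\<close> which taking differences merely translates. Hence iterated differences
  of it are never divisible by a prime.\<close>

definition hexagon :: "6 \<Rightarrow> int" where
  "hexagon h = (if h = 0 \<or> h = 1 then 1 else if h = 3 \<or> h = 4 then - 1 else 0)"

lemma hexagon_Suc: "hexagon (h + 1) = hexagon h + hexagon (h + 2)"
proof (cases h)
  case (of_int z)
  then have "z \<in> {0, 1, 2, 3, 4, 5}" by auto
  then show ?thesis using of_int by (auto simp: hexagon_def)
qed

section \<open>Isolating a single coefficient by differences\<close>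

text \<open>The products for \<open>b\<close> and for \<open>b\<close> raised by one at
  \<open>q j (\<kappa> g j)\<close> are compared. Elements that differ from \<open>g\<close> at
  \<open>j\<close> drop out; by \<open>hexagon_Suc\<close> the others keep a weight of the same
  shape, its argument raised by \<open>2\<close>. After all \<open>j\<close> in \<open>N\<close>
  only \<open>g\<close> is left.\<close>

lemma (in comm_group) hexagon_independence:
  fixes q :: "nat \<Rightarrow> int \<Rightarrow> int" and \<kappa> :: "'i \<Rightarrow> nat \<Rightarrow> int"
  assumes K: "finite K" and N: "finite N" and f: "f \<in> K \<rightarrow> carrier G"
    and distinct: "\<And>g h. \<lbrakk>g \<in> K; h \<in> K; \<forall>n\<in>N. \<kappa> g n = \<kappa> h n\<rbrakk> \<Longrightarrow> g = h"
    and q: "\<And>i j k l. q i k = q j l \<Longrightarrow> i = j \<and> k = l"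
    and vanish: "\<And>b z. (\<Otimes>g\<in>K. f g [^] hexagon (z + (\<Sum>n\<in>N. b (q n (\<kappa> g n))))) = \<one>"
    and g: "g \<in> K"
  shows "f g = \<one>"
proof -
  define L where "L = (\<lambda>J. {h \<in> K. \<forall>n\<in>J. \<kappa> h n = \<kappa> g n})"
  define H where "H = (\<lambda>b z h. z + (\<Sum>n\<in>N. b (q n (\<kappa> h n))) :: 6)"
  have "\<forall>b z. (\<Otimes>h\<in>L J. f h [^] hexagon (H b z h)) = \<one>" if "finite J" "J \<subseteq> N" for J
    using that
  proof (induction J)
    case empty
    then show ?case using vanish by (simp add: L_def H_def)
  next
    case (insert j J)
    have LK: "L J \<subseteq> K" "L (insert j J) \<subseteq> L J" and fin: "finite (L J)"
      using K by (auto simp: L_def)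
    have fL: "f h \<in> carrier G" if "h \<in> L J" for h using f LK that by blast
    have "(\<Otimes>h\<in>L (insert j J). f h [^] hexagon (H b (z + 2) h)) = \<one>" for b z
    proof -
      define b' where "b' = (\<lambda>p. b p + of_bool (p = q j (\<kappa> g j)))"
      let ?d = "\<lambda>h. if \<kappa> h j = \<kappa> g j then f h [^] hexagon (H b (z + 2) h) else \<one>"
      \<comment> \<open>Since \<open>q\<close> is injective in both arguments together, only the
        term \<open>n = j\<close> can hit the changed point.\<close>
      have "H b' z h = H b z h + of_bool (\<kappa> h j = \<kappa> g j)" for h
      proof -
        have "(\<Sum>n\<in>N. b' (q n (\<kappa> h n))) =
            (\<Sum>n\<in>N. b (q n (\<kappa> h n)) + (if n = j then of_bool (\<kappa> h j = \<kappa> g j) else 0))"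
          using q by (intro sum.cong) (auto simp: b'_def)
        then show ?thesis
          using N insert.prems by (simp add: H_def sum.distrib)
      qed
      then have "f h [^] hexagon (H b' z h) = f h [^] hexagon (H b z h) \<otimes> ?d h" if "h \<in> L J" for h
        using hexagon_Suc[of "H b z h"] fL[OF that] by (simp add: int_pow_mult H_def add_ac)
      then have "(\<Otimes>h\<in>L J. f h [^] hexagon (H b' z h)) =
          (\<Otimes>h\<in>L J. f h [^] hexagon (H b z h) \<otimes> ?d h)"
        using fL by (intro finprod_cong') auto
      also have "\<dots> = (\<Otimes>h\<in>L J. f h [^] hexagon (H b z h)) \<otimes> (\<Otimes>h\<in>L J. ?d h)"
        using fL by (intro finprod_multf) auto
      finally have "(\<Otimes>h\<in>L J. ?d h) = \<one>"
        using insert fL by (simp add: Pi_def)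
      moreover have "(\<Otimes>h\<in>L J. ?d h) = (\<Otimes>h\<in>L (insert j J). f h [^] hexagon (H b (z + 2) h))"
        using fL fin LK by (intro finprod_mono_neutral_cong_right) (auto simp: L_def)
      ultimately show ?thesis by simp
    qed
    \<comment> \<open>\<open>z\<close> runs through all integers modulo \<open>6\<close>, so the
      offset \<open>2\<close> is absorbed.\<close>
    from this[of _ "_ - 2"] show ?case by simp
  qed
  \<comment> \<open>At argument \<open>0\<close> the weight is \<open>1\<close>, so the last
    equation says that \<open>f g\<close> itself is trivial.\<close>
  then have "(\<Otimes>h\<in>L N. f h [^] hexagon (H (\<lambda>_. 0) 0 h)) = \<one>" using N by blast
  moreover have "L N = {g}" using g distinct by (auto simp: L_def)
  moreover have "f g \<in> carrier G" using f g by blast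
  ultimately show ?thesis by (simp add: H_def hexagon_def)
qed

lemma free_abelian_group_no_cancellation:
  fixes A :: "('a, 'k) monoid_scheme" and G :: "('g, 'm) monoid_scheme" and S :: "'s set"
  assumes A: "comm_group A" "finite (carrier A)" and G: "group G"
    and iso: "G \<cong> free_Abelian_group S" and "countable S"
  shows "\<exists>(\<Sigma> :: nat set) \<phi>. finite \<Sigma> \<and> card \<Sigma> \<ge> 2 \<and> \<phi> \<in> hom G (Aut_full_shift \<Sigma>) \<and>
           \<not> has_cancellation G (full_shift \<Sigma>) \<phi> A"
proof -
  interpret A: comm_group A by fact
  interpret G: group G by fact
  obtain \<nu> :: "'s \<Rightarrow> nat" where \<nu>: "inj_on \<nu> S"
    using \<open>countable S\<close> by (auto simp: countable_def)
  obtain c where "c \<in> iso G (free_Abelian_group S)"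
    using iso by (auto simp: is_iso_def)
  then have c: "c \<in> hom G (free_Abelian_group S)" and c_inj: "inj_on c (carrier G)"
    by (auto simp: iso_def bij_betw_def)
  \<comment> \<open>The coordinates of \<open>g\<close> in the basis, indexed by natural numbers
    through \<open>\<nu>\<close>; indices that \<open>\<nu>\<close> does not reach on
    \<open>S\<close> get the value \<open>0\<close>.\<close>
  define \<kappa> where "\<kappa> = (\<lambda>g n. if n \<in> \<nu> ` S then Poly_Mapping.lookup (c g) (inv_into S \<nu> n) else 0)"
  have keys: "Poly_Mapping.keys (c g) \<subseteq> S" if "g \<in> carrier G" for g
    using c that by (auto simp: hom_def Pi_def carrier_free_Abelian_group_iff)
  have fin: "finite {n. \<kappa> g n \<noteq> 0}" for g
  proof (rule finite_subset)
    show "{n. \<kappa> g n \<noteq> 0} \<subseteq> \<nu> ` Poly_Mapping.keys (c g)"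
      using \<nu> by (auto simp: \<kappa>_def in_keys_iff split: if_splits)
  qed simp
  have mult: "\<kappa> (g \<otimes>\<^bsub>G\<^esub> h) = (\<lambda>n. \<kappa> g n + \<kappa> h n)" if "g \<in> carrier G" "h \<in> carrier G" for g h
    using hom_mult[OF c that] by (auto simp: \<kappa>_def lookup_add)
  have one: "\<kappa> \<one>\<^bsub>G\<^esub> = (\<lambda>_. 0)"
    using mult[of "\<one>\<^bsub>G\<^esub>" "\<one>\<^bsub>G\<^esub>"] by (auto simp: fun_eq_iff)
  have inj: "g = h" if "g \<in> carrier G" "h \<in> carrier G" "\<kappa> g = \<kappa> h" for g h
  proof -
    have "Poly_Mapping.lookup (c g) s = Poly_Mapping.lookup (c h) s" for s
    proof (cases "s \<in> S")
      case True
      then show ?thesis using fun_cong[OF that(3), of "\<nu> s"] \<nu> by (simp add: \<kappa>_def)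
    next
      case False
      then have "s \<notin> Poly_Mapping.keys (c g)" "s \<notin> Poly_Mapping.keys (c h)" using keys that by auto
      then show ?thesis by (simp add: in_keys_iff)
    qed
    then have "c g = c h" by (rule poly_mapping_eqI)
    then show ?thesis using c_inj that by (auto dest: inj_onD)
  qed
  define v :: "6 cell \<Rightarrow> int" where "v = (\<lambda>s. hexagon (snd (snd s)))"
  show ?thesis
  proof (rule no_cancellationI[OF A G, where F = "\<lambda>g. transport (\<kappa> g)" and v = v])
    show "card (UNIV :: 6 cell set) \<ge> 2" by simp
    show "cellular (transport (\<kappa> g) :: (int \<Rightarrow> 6 cell) \<Rightarrow> _)" for g
      by (rule cellular_transport[OF fin])
    show "transport (\<kappa> \<one>\<^bsub>G\<^esub>) = id"
      by (simp only: one transport_zero)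
    show "transport (\<kappa> (g \<otimes>\<^bsub>G\<^esub> h)) = transport (\<kappa> g) \<circ> transport (\<kappa> h)"
      if "g \<in> carrier G" "h \<in> carrier G" for g h
      by (simp only: mult[OF that] transport_add[OF fin fin])
  next
    fix f assume f: "f \<in> carrier G \<rightarrow> carrier A"
      and supp: "finite {g \<in> carrier G. f g \<noteq> \<one>\<^bsub>A\<^esub>}" "{g \<in> carrier G. f g \<noteq> \<one>\<^bsub>A\<^esub>} \<noteq> {}"
    let ?K = "{g \<in> carrier G. f g \<noteq> \<one>\<^bsub>A\<^esub>}"
    \<comment> \<open>Outside \<open>?N\<close> all exponents of the support vanish, so those in
      \<open>?N\<close> tell its elements apart.\<close>
    let ?N = "\<Union>g\<in>?K. {n. \<kappa> g n \<noteq> 0}"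
    have N: "finite ?N" using supp fin by blast
    obtain g where g: "g \<in> ?K" using supp by blast
    show "\<exists>x. finprod A (\<lambda>g. f g [^]\<^bsub>A\<^esub> v (transport (\<kappa> g) x 0)) ?K \<noteq> \<one>\<^bsub>A\<^esub>"
    proof (rule ccontr)
      assume no: "\<nexists>x. finprod A (\<lambda>g. f g [^]\<^bsub>A\<^esub> v (transport (\<kappa> g) x 0)) ?K \<noteq> \<one>\<^bsub>A\<^esub>"
      have "f g = \<one>\<^bsub>A\<^esub>"
      proof (rule A.hexagon_independence[OF supp(1) N _ _ belt_site_inj _ g])
        show "f \<in> ?K \<rightarrow> carrier A" using f by auto
        show "g = h" if "g \<in> ?K" "h \<in> ?K" "\<forall>n\<in>?N. \<kappa> g n = \<kappa> h n" for g h
        proof -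
          have "\<kappa> g n = \<kappa> h n" for n
          proof (cases "n \<in> ?N")
            case False
            then have "\<kappa> g n = 0" "\<kappa> h n = 0" using that(1,2) by blast+
            then show ?thesis by simp
          qed (use that(3) in blast)
          then have "\<kappa> g = \<kappa> h" by blast
          then show ?thesis using inj that by blast
        qed
        fix b :: "int \<Rightarrow> 6" and z
        \<comment> \<open>The sum added to \<open>z\<close> cancels the reference sum that
          \<open>transport_paperfolding\<close> subtracts.\<close>
        let ?x = "\<lambda>j. (paperfolding j, (\<lambda>_ :: bool. b j), z + (\<Sum>n\<in>?N. b (belt_site n 0)))"
        have weight: "v (transport (\<kappa> g) ?x 0) = hexagon (z + (\<Sum>n\<in>?N. b (belt_site n (\<kappa> g n))))"
          if "g \<in> ?K" for g
        proof -
          have "{n. \<kappa> g n \<noteq> 0} \<subseteq> ?N" using that by blast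
          then show ?thesis unfolding v_def by (simp only: transport_paperfolding[OF N]) simp
        qed
        have "finprod A (\<lambda>g. f g [^]\<^bsub>A\<^esub> hexagon (z + (\<Sum>n\<in>?N. b (belt_site n (\<kappa> g n))))) ?K =
            finprod A (\<lambda>g. f g [^]\<^bsub>A\<^esub> v (transport (\<kappa> g) ?x 0)) ?K"
          using f weight by (intro A.finprod_cong') auto
        then show "finprod A (\<lambda>g. f g [^]\<^bsub>A\<^esub> hexagon (z + (\<Sum>n\<in>?N. b (belt_site n (\<kappa> g n))))) ?K = \<one>\<^bsub>A\<^esub>"
          using no by simp
      qed
      then show False using g by simp
    qed
  qed
qed

theorem mainTheorem7:
  fixes A :: "('a, 'k) monoid_scheme" and G :: "('g, 'm) monoid_scheme"
  assumes "comm_group A" and "finite (carrier A)"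
    and "is_free_abelian_group G \<or> is_free_group G"
    and "countable (carrier G)"
  shows "\<exists>(\<Sigma> :: nat set) \<phi>. finite \<Sigma> \<and> card \<Sigma> \<ge> 2 \<and>
           \<phi> \<in> hom G (Aut_full_shift \<Sigma>) \<and>
           \<not> has_cancellation G (full_shift \<Sigma>) \<phi> A"
proof -
  have G: "group G" and cases: "(\<exists>S :: 'g set. G \<cong> free_Abelian_group S) \<or> (\<exists>S. free_basis G S)"
    using assms(3) by (auto simp: is_free_abelian_group_def is_free_group_def)
  from cases show ?thesis
  proof (elim disjE exE)
    fix S :: "'g set"
    assume iso: "G \<cong> free_Abelian_group S"
    then obtain c where "c ` carrier G = carrier (free_Abelian_group S)"
      by (auto simp: is_iso_def iso_def bij_betw_def)
    then have "countable (carrier (free_Abelian_group S))"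
      using assms(4) by (metis countable_image)
    \<comment> \<open>The basis embeds through \<open>frag_of\<close>, so \<open>S\<close> inherits
      countability from the group.\<close>
    moreover have "frag_of ` S \<subseteq> carrier (free_Abelian_group S)"
      by (auto simp: carrier_free_Abelian_group_iff)
    ultimately have "countable (frag_of ` S)"
      by (rule countable_subset[rotated])
    then have "countable S"
      by (rule countable_image_inj_on) (auto simp: inj_on_def frag_of_eq)
    then show ?thesis
      by (rule free_abelian_group_no_cancellation[OF assms(1,2) G iso])
  next
    fix S assume S: "free_basis G S"
    then have "countable S"
      using assms(4) by (auto simp: free_basis_def intro: countable_subset)
    then show ?thesis
      by (rule free_group_no_cancellation[OF assms(1,2) G S])
  qed
qed

end
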